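(* Let $P>0$, let $N$ be a log-concave real random variable (noise) and let $Z$ be a centered Gaussian random variable with the same variance as $N$. Then $$C_P(Z)\ \leq\ C_P(N)\ \leq\ C_P(Z)+\tfrac12\log\left(\frac{2\pi}{e}\right).$$
   Context: A real random variable $X$ is log-concave if it has a density (with respect to Lebesgue measure) of the form $f=e^{-V}$, where $V:\mathbb{R}\to(-\infty,\infty]$ is convex. For a real random variable $X$ with density $f$, the differential entropy is $h(X)=-\int f\log f$, with $\log$ the natural logarithm and $0\log0=0$. For a real random variable $N$ (the additive noise) and power budget $P$, the capacity of the additive noise channel $X\mapsto X+N$ is $$C_P(N)=\sup_{X:\ \operatorname{Var}(X)\leq P}\big(h(X+N)-h(N)\big),$$ where the supremum is over real random variables $X$ independent of $N$ with $\operatorname{Var}(X)\le P$. *)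

theory Defs
  imports "HOL-Probability.Probability"
begin

text \<open>
  Convexity of \<open>V : \<real> \<rightarrow> (-\<infinity>, \<infinity>]\<close>; the library's \<^const>\<open>convex_on\<close> covers real-valued functions only.
  At \<open>t \<in> {0, 1}\<close> the convention \<open>0 * \<infinity> = 0\<close> of \<^typ>\<open>ereal\<close> makes the inequality trivial.
\<close>
definition ereal_convex :: "(real \<Rightarrow> ereal) \<Rightarrow> bool" where
  "ereal_convex V \<longleftrightarrow>
     (\<forall>x. V x \<noteq> -\<infinity>) \<and>
     (\<forall>x y t. 0 \<le> t \<and> t \<le> 1 \<longrightarrow>
        V ((1 - t) * x + t * y) \<le> ereal (1 - t) * V x + ereal t * V y)"

definition exp_minus :: "ereal \<Rightarrow> real" where
  "exp_minus v = (if v = \<infinity> then 0 else exp (- real_of_ereal v))"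

definition log_concave_rv :: "'a measure \<Rightarrow> ('a \<Rightarrow> real) \<Rightarrow> bool" where
  "log_concave_rv M X \<longleftrightarrow>
     (\<exists>V. ereal_convex V \<and> distributed M lborel X (\<lambda>x. ennreal (exp_minus (V x))))"

text \<open>
  If \<open>X\<close> has density \<open>f\<close> with respect to Lebesgue measure, this is \<open>- \<integral> f log f\<close> with the natural
  logarithm (and \<open>0 log 0 = 0\<close>), by \<open>information_space.entropy_distr\<close>. It is meaningful only if
  \<open>f log f\<close> is integrable.
\<close>
definition differential_entropy :: "'a measure \<Rightarrow> ('a \<Rightarrow> real) \<Rightarrow> real" where
  "differential_entropy M X = prob_space.entropy M (exp 1) lborel X"

text \<open>
  The space \<open>M\<close> carrying \<open>N\<close> may be too small to carry any other independent random variables, so the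
  supremum is over all \<open>X\<close> independent of a copy \<open>N'\<close> of \<open>N\<close> on some probability space \<open>\<Omega>\<close>. Carriers
  in \<open>\<real> \<times> \<real>\<close> suffice, since they realise every joint law of \<open>(X, N')\<close>.
  Square integrability is explicit because the Bochner integral defining \<open>variance\<close> is \<open>0\<close> when it
  diverges. If \<open>N\<close> is log-concave, the density of \<open>X + N'\<close> is bounded and its variance is finite,
  so all entropies below are well defined and finite.
\<close>
definition channel_capacity :: "real \<Rightarrow> 'a measure \<Rightarrow> ('a \<Rightarrow> real) \<Rightarrow> ereal" where
  "channel_capacity P M N =
     Sup {ereal (differential_entropy \<Omega> (\<lambda>\<omega>. X \<omega> + N' \<omega>) - differential_entropy \<Omega> N')
          | (\<Omega> :: (real \<times> real) measure) X N'.
            prob_space \<Omega> \<and>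
            prob_space.indep_var \<Omega> borel X borel N' \<and>
            distr \<Omega> borel N' = distr M borel N \<and>
            integrable \<Omega> (\<lambda>\<omega>. (X \<omega>)\<^sup>2) \<and>
            prob_space.variance \<Omega> X \<le> P}"

end

theory Submission
  imports Defs "HOL-Real_Asymp.Real_Asymp"
begin

text \<open>
  Let \<open>\<sigma>\<^sup>2\<close> be the common variance and \<open>C = 1/2 log (1 + P / \<sigma>\<^sup>2)\<close>. The claim follows from
  \<open>C_P(Z) = C \<le> C_P(N) \<le> C + 1/2 log (2\<pi> / e)\<close>, that is, from three facts.

  For any noise with a bounded density, \<open>X + N\<close> has variance at most \<open>P + \<sigma>\<^sup>2\<close>, so its entropy is at
  most that of a Gaussian of this variance: \<open>C_P(N) \<le> 1/2 log (2\<pi>e (P + \<sigma>\<^sup>2)) - h(N)\<close>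
  (\<open>channel_capacity_le\<close>). For Gaussian noise the right-hand side is \<open>C\<close>.

  Gaussian noise is the worst noise of its variance: with a Gaussian input \<open>X\<close> of variance \<open>P\<close>, the
  inequality \<open>h(X + N) - h(N) \<ge> C\<close> says that the relative entropy of \<open>X + N\<close> with respect to the
  Gaussian of the same mean and variance is at most that of \<open>N\<close>. This is the data-processing inequality
  for the channel that adds \<open>X\<close> (\<open>relative_entropy_convolution\<close>, \<open>channel_capacity_ge\<close>).

  Among log-concave densities of variance \<open>\<sigma>\<^sup>2\<close> the exponential has the least entropy:
  \<open>h(N) \<ge> 1 + log \<sigma>\<close> (\<open>log_concave_entropy_ge\<close>). This turns the first bound into the upper bound of the
  claim, and it is the hard part; in scale-free form it reads \<open>Var \<le> exp (2h - 2)\<close>.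

  For its proof cut the density at its mode. On one side, \<open>f = exp (- V)\<close> is nonincreasing
  on \<open>[0, b]\<close>. For the law of the residual life beyond \<open>x\<close>, with tail mass \<open>T\<close>, consider the
  hazard rate \<open>r = f / T\<close>, the mean \<open>m\<close>, the variance \<open>v\<close> and the entropy \<open>h\<close>. All but \<open>r\<close> satisfy simple
  differential equations in \<open>x\<close>, and log-concavity makes \<open>r\<close> increase; hence \<open>1/2 \<le> r m \<le> 1\<close> and
  \<open>v \<le> m\<^sup>2\<close>. One gets \<open>h \<ge> 2 r m - 1 - log r\<close> (\<open>entropy_vs_mean\<close>) by integrating a derivative of constant
  sign. For the gap \<open>D = 2h - 2 - log v\<close> the equation is
  \<open>(T D)' = f (log (r\<^sup>2 v) + m\<^sup>2 / v - 1)\<close>. Where \<open>D < 0\<close>, the bound just mentioned keeps \<open>r\<^sup>2 v\<close>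
  from being small, and this forces the right-hand side to be nonpositive; so \<open>T D\<close>, once
  negative, stays below a negative constant, whereas its lower limit at \<open>b\<close> is at least \<open>0\<close>. Thus
  \<open>D \<ge> 0\<close> (\<open>variance_le_exp_entropy\<close>).

  With masses \<open>p\<close> and \<open>q\<close> on the two sides of the mode, variance and entropy of the whole density are
  elementary expressions in \<open>p\<close>, \<open>q\<close> and the one-sided quantities, and the claim becomes an inequality in
  real numbers (\<open>two_sided_inequality\<close>). There the variance is bounded by
  the cubic Hermite interpolant of an exponential function of \<open>q\<close> at \<open>0\<close> and \<open>1\<close>, which lies below that function. A general
  log-concave density is exhausted by compact intervals inside its support.
\<close>

section \<open>Monotonicity from one-sided derivatives\<close>

text \<open>
  A convex function may have different derivatives from the left and from the right, so the usual mean value argument is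
  not available. The derivative condition is imposed below the level \<open>c\<close> only, in view of a quantity whose derivative
  is known to be nonpositive just where the quantity is negative; as long as \<open>F\<close> has not increased, it is below \<open>c\<close>.
\<close>
lemma nonincreasing_from_right_derivative:
  fixes F :: "real \<Rightarrow> real"
  assumes xy: "x \<le> y" and cont: "continuous_on {x..y} F" and Fx: "F x < c"
    and der: "\<And>z. x \<le> z \<Longrightarrow> z < y \<Longrightarrow> F z < c \<Longrightarrow> \<exists>D\<le>0. (F has_real_derivative D) (at_right z)"
  shows "F y \<le> F x"
proof -
  \<comment> \<open>The largest interval on which the graph of F stays below a line of slope e cannot end before y.\<close>
  have main: "F y \<le> F x + e * (y - x)" if e: "e > 0" "F x + e * (y - x) < c" for e
  proof -
    define A where "A = {z\<in>{x..y}. \<forall>w\<in>{x..z}. F w \<le> F x + e * (w - x)}"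
    define s where "s = Sup A"
    have xA: "x \<in> A" using xy by (auto simp: A_def)
    have bdd: "bdd_above A" by (auto simp: A_def intro!: bdd_aboveI[of _ y])
    have sxy: "x \<le> s" "s \<le> y"
    proof -
      show "x \<le> s" unfolding s_def by (rule cSup_upper[OF xA bdd])
      show "s \<le> y" unfolding s_def by (rule cSup_least) (use xA in \<open>auto simp: A_def\<close>)
    qed
    have less: "F w \<le> F x + e * (w - x)" if w: "x \<le> w" "w < s" for w
    proof -
      obtain z where "z \<in> A" "w < z" using w(2) less_cSup_iff[OF _ bdd, of w] xA unfolding s_def by (metis empty_iff)
      then show ?thesis using w by (auto simp: A_def)
    qed
    have Fs: "F s \<le> F x + e * (s - x)"
    proof (cases "x = s")
      case False
      then have "x < s" using sxy by simp
      have "closed ({x..y} \<inter> (\<lambda>w. F w - e * (w - x)) -` {..F x})"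
        by (intro continuous_closed_preimage continuous_intros cont)
      moreover have "{x<..<s} \<subseteq> {x..y} \<inter> (\<lambda>w. F w - e * (w - x)) -` {..F x}"
      proof
        fix w assume "w \<in> {x<..<s}"
        then show "w \<in> {x..y} \<inter> (\<lambda>w. F w - e * (w - x)) -` {..F x}"
          using less[of w] sxy by auto
      qed
      ultimately have "closure {x<..<s} \<subseteq> {x..y} \<inter> (\<lambda>w. F w - e * (w - x)) -` {..F x}"
        by (rule closure_minimal[rotated])
      moreover have "s \<in> closure {x<..<s}" using \<open>x < s\<close> by simp
      ultimately have "s \<in> (\<lambda>w. F w - e * (w - x)) -` {..F x}" by blast
      then show ?thesis by simp
    qed simp
    have "s = y"
    proof (rule ccontr)
      assume "s \<noteq> y"
      then have "s < y" using sxy by simp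
      have "e * (s - x) \<le> e * (y - x)" using e sxy by (intro mult_left_mono) auto
      then have "F s < c" using Fs e by linarith
      then obtain D where D: "D \<le> 0" "(F has_real_derivative D) (at_right s)"
        using der[of s] sxy \<open>s < y\<close> by auto
      from D(2) have "((\<lambda>z. (F z - F s) / (z - s)) \<longlongrightarrow> D) (at_right s)"
        by (simp add: has_field_derivative_iff)
      then have "\<forall>\<^sub>F z in at_right s. (F z - F s) / (z - s) < e"
        by (rule order_tendstoD(2)) (use D(1) e(1) in linarith)
      then obtain d where d: "d > s" "\<And>z. s < z \<Longrightarrow> z < d \<Longrightarrow> (F z - F s) / (z - s) < e"
        unfolding eventually_at_right_field by blast
      define t where "t = min ((s + d) / 2) y"
      have t: "s < t" "t < d" "t \<le> y" using d \<open>s < y\<close> by (auto simp: t_def min_def)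
      have "F w \<le> F x + e * (w - x)" if "x \<le> w" "w \<le> t" for w
      proof (cases "w \<le> s")
        case True
        then show ?thesis using less[of w] that Fs by (cases "w = s") auto
      next
        case False
        then have "(F w - F s) / (w - s) < e" using d t that by auto
        then have "F w - F s \<le> e * (w - s)" using False by (simp add: field_simps)
        then show ?thesis using Fs by (simp add: algebra_simps)
      qed
      then have "t \<in> A" using t sxy by (auto simp: A_def)
      then have "t \<le> s" unfolding s_def by (rule cSup_upper[OF _ bdd])
      then show False using t by simp
    qed
    then show ?thesis using Fs by simp
  qed
  show ?thesis
  proof (cases "x = y")
    case False
    then have pos: "y - x > 0" using xy by simp
    show ?thesis
    proof (rule field_le_epsilon)
      fix e :: real assume "e > 0"
      \<comment> \<open>Small enough for the line to stay below c on the whole interval.\<close>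
      define e' where "e' = min (e / (y - x)) ((c - F x) / 2 / (y - x))"
      have "e' > 0" using \<open>e > 0\<close> pos Fx by (auto simp: e'_def)
      have "e' \<le> e / (y - x)" "e' \<le> (c - F x) / 2 / (y - x)" by (auto simp: e'_def)
      then have "e' * (y - x) \<le> e" "e' * (y - x) \<le> (c - F x) / 2"
        unfolding pos_le_divide_eq[OF pos] .
      with main[of e'] \<open>e' > 0\<close> Fx show "F y \<le> F x + e" by simp
    qed
  qed simp
qed

lemma nonincreasing_from_right_derivative':
  fixes F :: "real \<Rightarrow> real"
  assumes "x \<le> y" "continuous_on {x..y} F"
    and "\<And>z. x \<le> z \<Longrightarrow> z < y \<Longrightarrow> \<exists>D\<le>0. (F has_real_derivative D) (at_right z)"
  shows "F y \<le> F x"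
  by (rule nonincreasing_from_right_derivative[where c = "F x + 1"]) (use assms in auto)

text \<open>
  The slopes from \<open>x\<close> to points on its right decrease towards their infimum by convexity. Monotonicity bounds them
  below by \<open>0\<close>, so that the left end point is included as well.
\<close>
lemma nondecreasing_convex_right_derivative:
  fixes V :: "real \<Rightarrow> real"
  assumes cvx: "convex_on {0..b} V" and mono: "mono_on {0..b} V"
  obtains v where "\<And>x. 0 \<le> x \<Longrightarrow> x < b \<Longrightarrow> (V has_real_derivative v x) (at_right x)"
    "\<And>x y. 0 \<le> x \<Longrightarrow> x \<le> y \<Longrightarrow> y < b \<Longrightarrow> v x \<le> v y"
proof -
  define s where "s x z = (V z - V x) / (z - x)" for x z
  define v where "v x = Inf (s x ` {x<..b})" for x
  have s0: "0 \<le> s x z" if "0 \<le> x" "x < z" "z \<le> b" for x z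
    using mono_onD[OF mono, of x z] that by (simp add: s_def)
  have smono: "s x z \<le> s x w" if "0 \<le> x" "x < z" "z \<le> w" "w \<le> b" for x z w
  proof (cases "z = w")
    case False
    have "(V x - V z) / (x - z) \<le> (V x - V w) / (x - w)"
      by (rule convex_on_slope_le[OF cvx]) (use that False in auto)
    then show ?thesis using that by (simp add: s_def minus_divide_left[symmetric] divide_simps split: if_splits)
      (smt (verit) mult_minus_left mult_minus_right)
  qed simp
  have bdd: "bdd_below (s x ` {x<..b})" if "0 \<le> x" for x
    using s0[OF that] by (auto intro!: bdd_belowI[of _ 0])
  have vle: "v x \<le> s x z" if "0 \<le> x" "x < z" "z \<le> b" for x z
    unfolding v_def by (rule cInf_lower) (use that bdd in auto)
  have lev: "c \<le> v x" if "x < b" "\<And>z. x < z \<Longrightarrow> z \<le> b \<Longrightarrow> c \<le> s x z" for x c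
    unfolding v_def by (rule cInf_greatest) (use that in auto)
  have "(s x \<longlongrightarrow> v x) (at_right x)" if "0 \<le> x" "x < b" for x
  proof (rule order_tendstoI)
    fix a assume "a < v x"
    have "\<forall>\<^sub>F z in at_right x. x < z \<and> z < b"
      using that by (auto simp: eventually_at_right_field)
    then show "\<forall>\<^sub>F z in at_right x. a < s x z"
      by eventually_elim (use vle that \<open>a < v x\<close> in force)
  next
    fix a assume "v x < a"
    then have "\<not> (\<forall>z. x < z \<longrightarrow> z \<le> b \<longrightarrow> a \<le> s x z)"
      using lev[of x a] that(2) by force
    then obtain z where z: "x < z" "z \<le> b" "s x z < a"
      by (auto simp: not_le)
    have "\<forall>\<^sub>F w in at_right x. x < w \<and> w < z"
      using z by (auto simp: eventually_at_right_field)
    then show "\<forall>\<^sub>F w in at_right x. s x w < a"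
      by eventually_elim (use smono[of x _ z] that z in force)
  qed
  then have 1: "(V has_real_derivative v x) (at_right x)" if "0 \<le> x" "x < b" for x
    using that by (simp add: has_field_derivative_iff s_def[abs_def])
  have 2: "v x \<le> v y" if "0 \<le> x" "x \<le> y" "y < b" for x y
  proof (cases "x = y")
    case False
    show ?thesis
    proof (rule lev)
      fix z assume z: "y < z" "z \<le> b"
      have "v x \<le> s x z" using that z by (intro vle) auto
      also have "s x z \<le> s y z"
      proof -
        have le: "s x y \<le> s x z" using smono[of x y z] that z False by auto
        have "(z - x) * s x z = V z - V x" "(y - x) * s x y = V y - V x" "(z - y) * s y z = V z - V y"
          using that z False by (auto simp: s_def)
        then have "(z - y) * s y z = (z - x) * s x z - (y - x) * s x y" by linarith
        also have "\<dots> \<ge> (z - x) * s x z - (y - x) * s x z"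
          using le that by (intro diff_left_mono mult_left_mono) auto
        finally have "(z - y) * s x z \<le> (z - y) * s y z" by (simp add: algebra_simps)
        then show ?thesis using z by simp
      qed
      finally show "v x \<le> s y z" .
    qed (use that in auto)
  qed simp
  show ?thesis using that 1 2 by blast
qed

lemma at_right_derivative_if_within:
  assumes "(F has_real_derivative D) (at x within {a..b})" "a \<le> x" "x < (b::real)"
  shows "(F has_real_derivative D) (at_right x)"
  using has_field_derivative_subset[OF assms(1), of "{x..b}"] assms(2,3)
  by (auto simp: at_within_Icc_at_right)

section \<open>Nonincreasing log-concave densities on an interval\<close>

lemma exp_le_one_plus_double:
  fixes t :: real
  assumes "0 \<le> t" "t \<le> 1"
  shows "exp t \<le> 1 + 2 * t"
proof -
  have "convex_on UNIV (exp :: real \<Rightarrow> real)"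
    by (rule f''_ge0_imp_convex[where f' = exp and f'' = exp]) (auto intro!: derivative_eq_intros)
  then have "exp ((1 - t) *\<^sub>R 0 + t *\<^sub>R 1) \<le> (1 - t) * exp 0 + t * exp (1::real)"
    by (rule convex_onD) (use assms in auto)
  moreover have "t * exp 1 \<le> t * 3" using assms exp_le by (intro mult_left_mono) auto
  ultimately show ?thesis by simp
qed

text \<open>
  This and the next lemma are the scalar part of the differential inequality for the gap between entropy and variance.
\<close>
lemma one_minus_sq_le:
  fixes y :: real
  assumes "0 \<le> y" "y \<le> 1 / 2"
  shows "(1 - y)\<^sup>2 * exp (4 * y) \<le> 1 + 4 * y"
proof -
  have "(1 - y)\<^sup>2 \<le> (exp (- y))\<^sup>2"
    using exp_ge_add_one_self[of "-y"] assms by (intro power_mono) auto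
  then have "(1 - y)\<^sup>2 * exp (4 * y) \<le> (exp (- y))\<^sup>2 * exp (4 * y)"
    by (intro mult_right_mono) auto
  also have "\<dots> = exp (2 * y)" by (simp add: power2_eq_square flip: exp_add)
  also have "\<dots> \<le> 1 + 4 * y" using exp_le_one_plus_double[of "2 * y"] assms by simp
  finally show ?thesis .
qed

text \<open>
  As a function of \<open>c = 1 / \<beta>\<close> the left-hand side is \<open>a\<^sup>2 c - ln c\<close>, which is convex, so it suffices to look at the two ends
  of the range of \<open>c\<close>.
\<close>
lemma log_plus_ratio_le_one:
  fixes a \<beta> :: real
  assumes a: "1 / 2 \<le> a" "a \<le> 1" and \<beta>: "exp (- 4 * (1 - a)) \<le> \<beta>" "\<beta> \<le> 1"
  shows "ln \<beta> + a\<^sup>2 / \<beta> \<le> 1"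
proof -
  have pos: "0 < \<beta>" using \<beta>(1) by (smt (verit) exp_gt_zero)
  define c where "c = 1 / \<beta>"
  define C where "C = exp (4 * (1 - a))"
  have c: "1 \<le> c" "c \<le> C"
  proof -
    show "1 \<le> c" using \<beta> pos by (simp add: c_def)
    have "C * exp (- 4 * (1 - a)) = 1" unfolding C_def exp_add[symmetric] by simp
    moreover have "C * exp (- 4 * (1 - a)) \<le> C * \<beta>"
      using \<beta>(1) by (intro mult_left_mono) (auto simp: C_def)
    ultimately show "c \<le> C" using pos by (simp add: c_def divide_le_eq)
  qed
  have eq: "ln \<beta> + a\<^sup>2 / \<beta> = a\<^sup>2 * c - ln c" using pos by (simp add: c_def ln_div)
  have cvx: "convex_on {0<..} (\<lambda>c. a\<^sup>2 * c - ln c)"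
    by (rule f''_ge0_imp_convex[where f' = "\<lambda>c. a\<^sup>2 - 1 / c" and f'' = "\<lambda>c. 1 / c\<^sup>2"])
      (auto intro!: derivative_eq_intros simp: field_simps power2_eq_square)
  have "a\<^sup>2 \<le> 1" using a by (simp add: power_le_one)
  moreover have "a\<^sup>2 * C - ln C \<le> 1"
    using one_minus_sq_le[of "1 - a"] a by (simp add: C_def)
  ultimately have ends: "a\<^sup>2 * 1 - ln 1 \<le> 1" "a\<^sup>2 * C - ln C \<le> 1" by auto
  show ?thesis
  proof (cases "C = 1")
    case True
    then show ?thesis using eq c ends by simp
  next
    case False
    then have C: "C > 1" using c by simp
    define t where "t = (c - 1) / (C - 1)"
    have t: "0 \<le> t" "t \<le> 1" using c C by (auto simp: t_def field_simps)
    have "t * (C - 1) = c - 1" using C by (simp add: t_def)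
    then have ct: "c = (1 - t) *\<^sub>R 1 + t *\<^sub>R C" by (simp add: algebra_simps)
    have "a\<^sup>2 * c - ln c \<le> (1 - t) * (a\<^sup>2 * 1 - ln 1) + t * (a\<^sup>2 * C - ln C)"
      unfolding ct by (rule convex_onD[OF cvx]) (use t C in auto)
    also have "\<dots> \<le> (1 - t) * 1 + t * 1"
      using ends t by (intro add_mono mult_left_mono) auto
    finally show ?thesis using eq by simp
  qed
qed

text \<open>
  One side of a log-concave density \<open>exp (- V)\<close>, seen from its mode, which is placed at \<open>0\<close>. The density is not
  normalised, because the statements are applied to all tails \<open>[x, b]\<close> of the same density.
\<close>
locale decreasing_log_concave =
  fixes V :: "real \<Rightarrow> real" and b :: real
  assumes b_pos: "0 < b"
    and convex_V: "convex_on {0..b} V"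
    and mono_V: "mono_on {0..b} V"
    and cont_V: "continuous_on {0..b} V"
begin

text \<open>
  Below, \<open>T\<close> is the mass of the tail \<open>[x, b]\<close>; the residual life beyond \<open>x\<close> has mean \<open>S1 / T\<close>,
  second moment \<open>2 * S2 / T\<close> and entropy \<open>L / T + ln T\<close>. Iterated integrals are used because their derivatives are
  immediate.
\<close>
definition f where "f x = exp (- V x)"
definition T where "T x = integral {x..b} f"
definition S1 where "S1 x = integral {x..b} T"
definition S2 where "S2 x = integral {x..b} S1"
definition L where "L x = integral {x..b} (\<lambda>y. f y * V y)"

lemma f_pos[simp]: "0 < f x" and f_nonneg[simp]: "0 \<le> f x" by (simp_all add: f_def)

lemma cont_f: "continuous_on {0..b} f"
  unfolding f_def by (intro continuous_intros cont_V)

lemma der_T: "x \<in> {0..b} \<Longrightarrow> (T has_real_derivative - f x) (at x within {0..b})"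
  unfolding T_def by (rule integral_has_real_derivative'[OF cont_f])

lemma cont_T: "continuous_on {0..b} T"
  using der_T by (intro DERIV_continuous_on)

lemma der_S1: "x \<in> {0..b} \<Longrightarrow> (S1 has_real_derivative - T x) (at x within {0..b})"
  unfolding S1_def by (rule integral_has_real_derivative'[OF cont_T])

lemma cont_S1: "continuous_on {0..b} S1"
  using der_S1 by (intro DERIV_continuous_on)

lemma der_S2: "x \<in> {0..b} \<Longrightarrow> (S2 has_real_derivative - S1 x) (at x within {0..b})"
  unfolding S2_def by (rule integral_has_real_derivative'[OF cont_S1])

lemma cont_S2: "continuous_on {0..b} S2"
  using der_S2 by (intro DERIV_continuous_on)

lemma der_L: "x \<in> {0..b} \<Longrightarrow> (L has_real_derivative - (f x * V x)) (at x within {0..b})"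
  unfolding L_def by (rule integral_has_real_derivative') (intro continuous_intros cont_f cont_V)

lemma cont_L: "continuous_on {0..b} L"
  using der_L by (intro DERIV_continuous_on)

lemma end_zero[simp]: "T b = 0" "S1 b = 0" "S2 b = 0" "L b = 0"
  by (simp_all add: T_def S1_def S2_def L_def)

definition slope where "slope = (SOME slope.
   (\<forall>x. 0 \<le> x \<longrightarrow> x < b \<longrightarrow> (V has_real_derivative slope x) (at_right x)) \<and>
   (\<forall>x y. 0 \<le> x \<longrightarrow> x \<le> y \<longrightarrow> y < b \<longrightarrow> slope x \<le> slope y))"

lemma slope:
  "0 \<le> x \<Longrightarrow> x < b \<Longrightarrow> (V has_real_derivative slope x) (at_right x)"
  "0 \<le> x \<Longrightarrow> x \<le> y \<Longrightarrow> y < b \<Longrightarrow> slope x \<le> slope y"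
proof -
  have "\<exists>slope. (\<forall>x. 0 \<le> x \<longrightarrow> x < b \<longrightarrow> (V has_real_derivative slope x) (at_right x)) \<and>
   (\<forall>x y. 0 \<le> x \<longrightarrow> x \<le> y \<longrightarrow> y < b \<longrightarrow> slope x \<le> slope y)"
    by (rule nondecreasing_convex_right_derivative[OF convex_V mono_V]) blast
  from someI_ex[OF this]
  show "0 \<le> x \<Longrightarrow> x < b \<Longrightarrow> (V has_real_derivative slope x) (at_right x)"
      "0 \<le> x \<Longrightarrow> x \<le> y \<Longrightarrow> y < b \<Longrightarrow> slope x \<le> slope y"
    unfolding slope_def[symmetric] by blast+
qed

lemma der_right:
  assumes "0 \<le> x" "x < b"
  shows "(V has_real_derivative slope x) (at_right x)"
    "(f has_real_derivative - slope x * f x) (at_right x)"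
    "(T has_real_derivative - f x) (at_right x)"
    "(S1 has_real_derivative - T x) (at_right x)"
    "(S2 has_real_derivative - S1 x) (at_right x)"
    "(L has_real_derivative - (f x * V x)) (at_right x)"
proof -
  show V: "(V has_real_derivative slope x) (at_right x)" using slope assms by simp
  show "(f has_real_derivative - slope x * f x) (at_right x)"
    unfolding f_def by (rule derivative_eq_intros V refl | simp)+
  have x: "x \<in> {0..b}" using assms by simp
  show "(T has_real_derivative - f x) (at_right x)"
    "(S1 has_real_derivative - T x) (at_right x)"
    "(S2 has_real_derivative - S1 x) (at_right x)"
    "(L has_real_derivative - (f x * V x)) (at_right x)"
    using assms by (auto intro!: at_right_derivative_if_within der_T[OF x] der_S1[OF x] der_S2[OF x] der_L[OF x])
qed

lemma cont_on:
  assumes "0 \<le> x" "y \<le> b"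
  shows "continuous_on {x..y} V" "continuous_on {x..y} f" "continuous_on {x..y} T" "continuous_on {x..y} S1"
    "continuous_on {x..y} S2" "continuous_on {x..y} L"
  using assms by (auto intro: continuous_on_subset[OF cont_V] continuous_on_subset[OF cont_f]
   continuous_on_subset[OF cont_T] continuous_on_subset[OF cont_S1]
   continuous_on_subset[OF cont_S2] continuous_on_subset[OF cont_L])

lemma integral_pos:
  assumes "0 \<le> x" "x < b" "continuous_on {0..b} g" "\<And>y. 0 \<le> y \<Longrightarrow> y < b \<Longrightarrow> 0 < g y"
  shows "0 < integral {x..b} (g :: real \<Rightarrow> real)"
proof -
  define h where "h y = integral {y..b} g" for y
  have "h b < h x"
  proof (rule DERIV_neg_imp_decreasing_open[OF assms(2)])
    fix y assume y: "x < y" "y < b"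
    have "(h has_real_derivative - g y) (at y within {0..b})"
      unfolding h_def by (rule integral_has_real_derivative') (use assms y in auto)
    moreover have "at y within {0..b} = at y" using y assms by (intro at_within_Icc_at) auto
    ultimately show "\<exists>D. (h has_real_derivative D) (at y) \<and> D < 0"
      using assms y by (auto intro!: exI[of _ "- g y"])
  next
    have "continuous_on {0..b} h"
      unfolding h_def using integral_has_real_derivative'[OF assms(3)] by (intro DERIV_continuous_on)
    then show "continuous_on {x..b} h" by (rule continuous_on_subset) (use assms in auto)
  qed
  then show ?thesis by (simp add: h_def)
qed

lemma T_pos: "0 \<le> x \<Longrightarrow> x < b \<Longrightarrow> 0 < T x"
  unfolding T_def by (rule integral_pos) (auto simp: cont_f)
lemma S1_pos: "0 \<le> x \<Longrightarrow> x < b \<Longrightarrow> 0 < S1 x"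
  unfolding S1_def by (rule integral_pos) (auto simp: cont_T T_pos)
lemma S2_pos: "0 \<le> x \<Longrightarrow> x < b \<Longrightarrow> 0 < S2 x"
  unfolding S2_def by (rule integral_pos) (auto simp: cont_S1 S1_pos)

text \<open>
  The density decays at least at the rate \<open>slope x\<close> beyond \<open>x\<close>, so the tail is at most that of an exponential.
\<close>
lemma slope_le_hazard:
  assumes x: "0 \<le> x" "x < b"
  shows "slope x * T x \<le> f x"
proof -
  have "f b - slope x * T b \<le> f x - slope x * T x"
  proof (rule nonincreasing_from_right_derivative'[where F = "\<lambda>z. f z - slope x * T z"])
    fix z assume z: "x \<le> z" "z < b"
    have z': "0 \<le> z" using z x by simp
    have "((\<lambda>z. f z - slope x * T z) has_real_derivative (- slope z * f z - slope x * - f z)) (at_right z)"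
      by (rule derivative_eq_intros der_right[OF z' z(2)] refl)+ simp
    moreover have "slope x * f z \<le> slope z * f z"
      using slope(2)[OF x(1) z] by (intro mult_right_mono) auto
    ultimately show "\<exists>D\<le>0. ((\<lambda>z. f z - slope x * T z) has_real_derivative D) (at_right z)"
      by (auto intro!: exI[of _ "- slope z * f z - slope x * - f z"])
  qed (use x in \<open>auto intro!: continuous_intros cont_on\<close>)
  then show ?thesis using f_nonneg[of b] unfolding end_zero by linarith
qed

lemma hazard_mono:
  assumes x: "0 \<le> x" "x \<le> y" "y < b"
  shows "f x / T x \<le> f y / T y"
proof -
  have "- (f y / T y) \<le> - (f x / T x)"
  proof (rule nonincreasing_from_right_derivative'[where F = "\<lambda>x. - (f x / T x)"])
    fix z assume z: "x \<le> z" "z < y"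
    have z': "0 \<le> z" "z < b" using z x by auto
    have T: "0 < T z" using T_pos z' by simp
    let ?D = "- ((- slope z * f z * T z - f z * - f z) / (T z * T z))"
    have "((\<lambda>x. - (f x / T x)) has_real_derivative ?D) (at_right z)"
      by (rule derivative_eq_intros der_right[OF z'] refl)+ (use T in auto)
    moreover have "slope z * T z * f z \<le> f z * f z"
      using slope_le_hazard[OF z'] by (intro mult_right_mono) auto
    then have "0 \<le> (- slope z * f z * T z - f z * - f z) / (T z * T z)"
      by (intro divide_nonneg_nonneg) (auto simp: mult_ac)
    then have "?D \<le> 0" by linarith
    ultimately show "\<exists>D\<le>0. ((\<lambda>x. - (f x / T x)) has_real_derivative D) (at_right z)" by blast
  next
    have "T z \<noteq> 0" if "x \<le> z" "z \<le> y" for z using T_pos[of z] x that by simp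
    then show "continuous_on {x..y} (\<lambda>x. - (f x / T x))"
      using x by (auto intro!: continuous_intros cont_on)
  qed (use x in auto)
  then show ?thesis by simp
qed

text \<open>
  Since the hazard rate increases, the residual life beyond \<open>x\<close> is dominated by an exponential variable with the hazard
  rate at \<open>x\<close>.
\<close>
lemma hazard_mean_le:
  assumes x: "0 \<le> x" "x < b"
  shows "f x * S1 x \<le> (T x)\<^sup>2"
proof -
  define r where "r = f x / T x"
  have "T b - r * S1 b \<le> T x - r * S1 x"
  proof (rule nonincreasing_from_right_derivative'[where F = "\<lambda>x. T x - r * S1 x"])
    fix z assume z: "x \<le> z" "z < b"
    have z': "0 \<le> z" "z < b" using z x by auto
    have "((\<lambda>x. T x - r * S1 x) has_real_derivative (- f z - r * - T z)) (at_right z)"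
      by (rule derivative_eq_intros der_right[OF z'] refl)+ simp
    moreover have "r * T z \<le> f z"
      using hazard_mono[OF x(1) z] T_pos[OF z'] by (simp add: r_def field_simps)
    ultimately show "\<exists>D\<le>0. ((\<lambda>x. T x - r * S1 x) has_real_derivative D) (at_right z)"
      by (auto intro!: exI[of _ "- f z - r * - T z"])
  qed (use x in \<open>auto intro!: continuous_intros cont_on\<close>)
  then show ?thesis using T_pos[OF x] by (simp add: r_def field_simps power2_eq_square)
qed

lemma mean_residual_antimono:
  assumes x: "0 \<le> x" "x \<le> y" "y < b"
  shows "S1 y / T y \<le> S1 x / T x"
proof (rule nonincreasing_from_right_derivative'[where F = "\<lambda>x. S1 x / T x"])
  fix z assume z: "x \<le> z" "z < y"
  have z': "0 \<le> z" "z < b" using z x by auto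
  have T: "0 < T z" using T_pos z' by simp
  let ?D = "(- T z * T z - S1 z * - f z) / (T z * T z)"
  have "((\<lambda>x. S1 x / T x) has_real_derivative ?D) (at_right z)"
    by (rule derivative_eq_intros der_right[OF z'] refl)+ (use T in auto)
  moreover have "?D \<le> 0"
    using hazard_mean_le[OF z'] by (intro divide_nonpos_nonneg) (auto simp: mult_ac power2_eq_square)
  ultimately show "\<exists>D\<le>0. ((\<lambda>x. S1 x / T x) has_real_derivative D) (at_right z)" by blast
next
  have "T z \<noteq> 0" if "x \<le> z" "z \<le> y" for z using T_pos[of z] x that by simp
  then show "continuous_on {x..y} (\<lambda>x. S1 x / T x)"
    using x by (auto intro!: continuous_intros cont_on)
qed (use x in auto)

text \<open>
  The variance of the residual life is at most the square of its mean, because the mean residual life decreases.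
\<close>
lemma second_moment_le:
  assumes x: "0 \<le> x" "x < b"
  shows "S2 x * T x \<le> (S1 x)\<^sup>2"
proof -
  define m where "m = S1 x / T x"
  have "m * S1 b - S2 b \<le> m * S1 x - S2 x"
  proof (rule nonincreasing_from_right_derivative'[where F = "\<lambda>x. m * S1 x - S2 x"])
    fix z assume z: "x \<le> z" "z < b"
    have z': "0 \<le> z" "z < b" using z x by auto
    have "((\<lambda>x. m * S1 x - S2 x) has_real_derivative (m * - T z - - S1 z)) (at_right z)"
      by (rule derivative_eq_intros der_right[OF z'] refl)+ simp
    moreover have "S1 z \<le> m * T z"
      using mean_residual_antimono[OF x(1) z] T_pos[OF z'] by (simp add: m_def field_simps)
    ultimately show "\<exists>D\<le>0. ((\<lambda>x. m * S1 x - S2 x) has_real_derivative D) (at_right z)"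
      by (auto intro!: exI[of _ "m * - T z - - S1 z"])
  qed (use x in \<open>auto intro!: continuous_intros cont_on\<close>)
  then show ?thesis using T_pos[OF x] by (simp add: m_def field_simps power2_eq_square)
qed

lemma f_antimono: "0 \<le> x \<Longrightarrow> x \<le> y \<Longrightarrow> y \<le> b \<Longrightarrow> f y \<le> f x"
  using mono_onD[OF mono_V, of x y] by (simp add: f_def)

text \<open>
  A density bounded by its initial value \<open>f x\<close> has at least the mean of the uniform density with that value.
\<close>
lemma hazard_mean_ge:
  assumes x: "0 \<le> x" "x < b"
  shows "(T x)\<^sup>2 \<le> 2 * f x * S1 x"
proof -
  have "2 * f x * S1 b - (T b)\<^sup>2 \<le> 2 * f x * S1 x - (T x)\<^sup>2"
  proof (rule nonincreasing_from_right_derivative'[where F = "\<lambda>z. 2 * f x * S1 z - (T z)\<^sup>2"])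
    fix z assume z: "x \<le> z" "z < b"
    have z': "0 \<le> z" "z < b" using z x by auto
    let ?D = "2 * f x * - T z - 2 * T z * - f z"
    have "((\<lambda>z. 2 * f x * S1 z - (T z)\<^sup>2) has_real_derivative ?D) (at_right z)"
      by (rule derivative_eq_intros der_right[OF z'] refl)+ simp
    moreover have "T z * f z \<le> T z * f x"
      using f_antimono[of x z] T_pos[OF z'] x z by (intro mult_left_mono) auto
    then have "?D \<le> 0" by (simp add: mult_ac)
    ultimately show "\<exists>D\<le>0. ((\<lambda>z. 2 * f x * S1 z - (T z)\<^sup>2) has_real_derivative D) (at_right z)" by blast
  qed (use x in \<open>auto intro!: continuous_intros cont_on\<close>)
  then show ?thesis by simp
qed

lemma variance_pos:
  assumes x: "0 \<le> x" "x < b"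
  shows "0 < 2 * S2 x * T x - (S1 x)\<^sup>2"
proof -
  let ?F = "\<lambda>z. 2 * S2 z * T z - (S1 z)\<^sup>2"
  have "?F b < ?F x"
  proof (rule DERIV_neg_imp_decreasing_open[OF x(2)])
    fix y assume y: "x < y" "y < b"
    have w: "at y within {0..b} = at y" using y x by (intro at_within_Icc_at) auto
    have y': "y \<in> {0..b}" using y x by auto
    have "(?F has_real_derivative - (2 * S2 y * f y)) (at y)"
      by (rule derivative_eq_intros der_T[OF y', unfolded w] der_S1[OF y', unfolded w]
         der_S2[OF y', unfolded w] refl)+ (simp add: algebra_simps)
    then show "\<exists>D. (?F has_real_derivative D) (at y) \<and> D < 0"
      using S2_pos[of y] x y by (auto intro!: exI[of _ "- (2 * S2 y * f y)"])
  qed (use x in \<open>auto intro!: continuous_intros cont_on\<close>)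
  then show ?thesis by simp
qed

text \<open>
  In terms of \<open>h = L / T + ln T\<close> and \<open>r = f / T\<close>, this and the next lemma say \<open>- ln r \<le> h \<le> 1 - ln r\<close>.
\<close>
lemma entropy_upper:
  assumes x: "0 \<le> x" "x < b"
  shows "L x \<le> T x + T x * V x"
proof -
  have "T b + T b * V b - L b \<le> T x + T x * V x - L x"
  proof (rule nonincreasing_from_right_derivative'[where F = "\<lambda>x. T x + T x * V x - L x"])
    fix z assume z: "x \<le> z" "z < b"
    have z': "0 \<le> z" "z < b" using z x by auto
    have "((\<lambda>x. T x + T x * V x - L x) has_real_derivative (- f z + (- f z * V z + slope z * T z) - - (f z * V z))) (at_right z)"
      by (rule derivative_eq_intros der_right[OF z'] refl)+
    then show "\<exists>D\<le>0. ((\<lambda>x. T x + T x * V x - L x) has_real_derivative D) (at_right z)"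
      using slope_le_hazard[OF z'] by (auto intro!: exI[of _ "- f z + (- f z * V z + slope z * T z) - - (f z * V z)"])
  qed (use x in \<open>auto intro!: continuous_intros cont_on\<close>)
  then show ?thesis by simp
qed

lemma entropy_lower:
  assumes x: "0 \<le> x" "x < b"
  shows "T x * V x \<le> L x"
proof -
  have "L b - T b * V x \<le> L x - T x * V x"
  proof (rule nonincreasing_from_right_derivative'[where F = "\<lambda>z. L z - T z * V x"])
    fix z assume z: "x \<le> z" "z < b"
    have z': "0 \<le> z" "z < b" using z x by auto
    have "((\<lambda>z. L z - T z * V x) has_real_derivative (- (f z * V z) - - f z * V x)) (at_right z)"
      by (rule derivative_eq_intros der_right[OF z'] refl)+ simp
    moreover have "f z * V x \<le> f z * V z"
      using mono_onD[OF mono_V, of x z] x z by (intro mult_left_mono) auto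
    ultimately show "\<exists>D\<le>0. ((\<lambda>z. L z - T z * V x) has_real_derivative D) (at_right z)"
      by (auto intro!: exI[of _ "- (f z * V z) - - f z * V x"])
  qed (use x in \<open>auto intro!: continuous_intros cont_on\<close>)
  then show ?thesis by simp
qed


lemma T_small:
  assumes x: "0 \<le> x" "x < b" and e: "0 < e"
  obtains y where "x < y" "y < b" "T y < e" "2 * S2 y < 1"
proof -
  have "continuous_on {0..b} (\<lambda>y. 2 * S2 y)" by (intro continuous_intros cont_S2)
  then have "(T \<longlongrightarrow> T b) (at b within {0..b})"
    "((\<lambda>y. 2 * S2 y) \<longlongrightarrow> 2 * S2 b) (at b within {0..b})"
    using cont_T b_pos unfolding continuous_on_def by (auto simp del: end_zero dest!: bspec[of _ _ b])
  then have "(T \<longlongrightarrow> 0) (at_left b)" "((\<lambda>y. 2 * S2 y) \<longlongrightarrow> 0) (at_left b)"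
    using b_pos by (simp_all add: at_within_Icc_at_left)
  then have "\<forall>\<^sub>F y in at_left b. T y < e" "\<forall>\<^sub>F y in at_left b. 2 * S2 y < 1"
    using e by (auto intro: order_tendstoD)
  moreover have "\<forall>\<^sub>F y in at_left b. x < y \<and> y < b"
    using x by (auto simp: eventually_at_left_field)
  ultimately have "\<forall>\<^sub>F y in at_left b. x < y \<and> y < b \<and> T y < e \<and> 2 * S2 y < 1"
    by eventually_elim auto
  then have "\<exists>y. x < y \<and> y < b \<and> T y < e \<and> 2 * S2 y < 1"
    by (rule eventually_happens'[rotated]) simp
  then show ?thesis using that by blast
qed

text \<open>
  In terms of the residual life beyond \<open>x\<close> this is \<open>h \<ge> 2 r m - 1 - ln r\<close>, with equality for uniform densities and for
  exponential densities on a half-line. The difference of the two sides, multiplied by \<open>T\<close>, has the right derivative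
  \<open>(f - T * slope) * (1 - 2 r m)\<close>, whose factors have opposite signs, and it is at least \<open>- T\<close>, so it
  decreases to a limit that is not negative.
\<close>
lemma entropy_vs_mean:
  assumes x: "0 \<le> x" "x < b"
  shows "2 * f x * S1 x / T x - T x \<le> L x - T x * V x"
proof -
  define F where "F x = L x - 2 * f x * S1 x / T x + T x - T x * V x" for x
  have mono: "F y \<le> F x" if y: "x \<le> y" "y < b" for y
  proof (rule nonincreasing_from_right_derivative'[where F = F])
    fix z assume z: "x \<le> z" "z < y"
    have z': "0 \<le> z" "z < b" using z x y by auto
    have T: "0 < T z" using T_pos z' by simp
    then have Tn: "T z \<noteq> 0" by simp
    let ?D = "(f z - T z * slope z) * (1 - 2 * f z * S1 z / (T z)\<^sup>2)"
    have "(F has_real_derivative ?D) (at_right z)"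
      unfolding F_def
      by (rule derivative_eq_intros der_right[OF z'] refl Tn)+
        (use T in \<open>simp_all add: field_simps power2_eq_square\<close>)
    moreover have "0 \<le> f z - T z * slope z" using slope_le_hazard[OF z'] by (simp add: mult_ac)
    moreover have "1 - 2 * f z * S1 z / (T z)\<^sup>2 \<le> 0"
      using hazard_mean_ge[OF z'] T by (simp add: field_simps)
    ultimately show "\<exists>D\<le>0. (F has_real_derivative D) (at_right z)"
      by (blast intro: mult_nonneg_nonpos)
  next
    have "T z \<noteq> 0" if "x \<le> z" "z \<le> y" for z using T_pos[of z] x y that by simp
    then show "continuous_on {x..y} F"
      using x y unfolding F_def by (auto intro!: continuous_intros cont_on)
  qed fact
  have lower: "- T y \<le> F y" if y: "0 \<le> y" "y < b" for y
  proof -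
    have "2 * f y * S1 y / T y \<le> 2 * T y"
      using hazard_mean_le[OF y] T_pos[OF y] by (simp add: field_simps power2_eq_square)
    then show ?thesis using entropy_lower[OF y] by (simp add: F_def)
  qed
  have "0 \<le> F x"
  proof (rule ccontr)
    assume "\<not> 0 \<le> F x"
    then have "0 < - F x" by simp
    then obtain y where y: "x < y" "y < b" "T y < - F x" using T_small[OF x] by metis
    then show False using mono[of y] lower[of y] x by simp
  qed
  then show ?thesis by (simp add: F_def)
qed

definition var where "var x = (2 * S2 x * T x - (S1 x)\<^sup>2) / (T x)\<^sup>2"

lemma var_pos: "0 \<le> x \<Longrightarrow> x < b \<Longrightarrow> 0 < var x"
  using variance_pos[of x] T_pos[of x] unfolding var_def by (intro divide_pos_pos) auto

lemma der_var:
  assumes z: "0 \<le> z" "z < b"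
  shows "(var has_real_derivative f z / T z * (var z - (S1 z / T z)\<^sup>2)) (at_right z)"
proof -
  have T: "T z > 0" using T_pos[OF z] .
  have "(var has_real_derivative (((- S1 z * 2) * T z + - f z * (2 * S2 z) - 2 * S1 z * - T z) * (T z)\<^sup>2
     - (2 * S2 z * T z - (S1 z)\<^sup>2) * (2 * T z * - f z)) / ((T z)\<^sup>2 * (T z)\<^sup>2)) (at_right z)"
    unfolding var_def
    by (rule derivative_eq_intros der_right[OF z] refl | use T in force)+
  also have "(((- S1 z * 2) * T z + - f z * (2 * S2 z) - 2 * S1 z * - T z) * (T z)\<^sup>2
     - (2 * S2 z * T z - (S1 z)\<^sup>2) * (2 * T z * - f z)) / ((T z)\<^sup>2 * (T z)\<^sup>2)
     = f z / T z * (var z - (S1 z / T z)\<^sup>2)"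
    using T by (simp add: var_def field_simps power2_eq_square)
  finally show ?thesis .
qed

text \<open>
  This is \<open>T * D\<close> for the gap \<open>D = 2 * h - 2 - ln var\<close> of the residual life. The factor \<open>T\<close> removes \<open>D\<close> itself from the
  formula for the derivative.
\<close>
definition entropy_gap where
  "entropy_gap x = 2 * L x + 2 * T x * ln (T x) - 2 * T x - T x * ln (var x)"

text \<open>
  The left-hand side tends to \<open>0\<close> with \<open>T y\<close>.
\<close>
lemma entropy_gap_near_end:
  assumes y: "0 \<le> y" "y < b" "2 * S2 y < 1"
  shows "2 * T y * V 0 + 3 * (T y * ln (T y)) - 2 * T y \<le> entropy_gap y"
proof -
  have T: "0 < T y" using T_pos y by simp
  have S2: "0 < S2 y" using S2_pos y by simp
  have "var y \<le> 2 * S2 y / T y" using T S1_pos[OF y(1,2)] by (simp add: var_def field_simps power2_eq_square zero_le_mult_iff)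
  then have "ln (var y) \<le> ln (2 * S2 y / T y)" using var_pos[OF y(1,2)] by simp
  also have "\<dots> = ln (2 * S2 y) - ln (T y)" using T S2 by (simp add: ln_div)
  also have "\<dots> \<le> - ln (T y)" using y(3) S2 by simp
  finally have "T y * ln (var y) \<le> T y * - ln (T y)" using T by (intro mult_left_mono) auto
  moreover have "T y * V 0 \<le> T y * V y"
    using mono_onD[OF mono_V, of 0 y] y T by (intro mult_left_mono) auto
  then have "T y * V 0 \<le> L y" using entropy_lower[OF y(1,2)] by simp
  ultimately show ?thesis by (simp add: entropy_gap_def)
qed

text \<open>
  The expression is the derivative of the gap, up to the factor \<open>f z\<close>. In terms of \<open>a = r m\<close> and
  \<open>\<beta> = r\<^sup>2 var\<close> it is \<open>ln \<beta> + a\<^sup>2 / \<beta> - 1\<close>, which is large for small \<open>\<beta>\<close>. But \<open>entropy_vs_mean\<close>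
  gives \<open>D \<ge> - 4 (1 - a) - ln \<beta>\<close>, so a negative gap excludes \<open>\<beta> \<le> exp (- 4 (1 - a))\<close>.
\<close>
lemma entropy_gap_slope_nonpos:
  assumes z: "0 \<le> z" "z < b" and gap: "entropy_gap z < 0"
  shows "2 * ln (f z / T z) + ln (var z) + (S1 z / T z)\<^sup>2 / var z - 1 \<le> 0"
proof -
  have T: "0 < T z" using T_pos z by simp
  have S1: "0 < S1 z" using S1_pos z by simp
  have vp: "0 < var z" using var_pos z by simp
  define a where "a = f z * S1 z / (T z)\<^sup>2"
  define \<beta> where "\<beta> = (f z / T z)\<^sup>2 * var z"
  have \<beta>pos: "0 < \<beta>" 
    unfolding \<beta>_def using vp T f_pos[of z] by (intro mult_pos_pos zero_less_power divide_pos_pos)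
  have a: "1 / 2 \<le> a" "a \<le> 1"
    using hazard_mean_ge[OF z] hazard_mean_le[OF z] T by (auto simp: a_def field_simps)
  have ln\<beta>: "ln \<beta> = 2 * ln (f z / T z) + ln (var z)"
    using vp T less_imp_neq[OF f_pos[of z]] by (simp add: \<beta>_def ln_mult ln_realpow)
  have "2 * S2 z * T z - (S1 z)\<^sup>2 \<le> (S1 z)\<^sup>2" using second_moment_le[OF z] by simp
  then have "var z \<le> (S1 z / T z)\<^sup>2" using T by (simp add: var_def power_divide divide_right_mono)
  then have "\<beta> \<le> (f z / T z)\<^sup>2 * (S1 z / T z)\<^sup>2" unfolding \<beta>_def by (rule mult_left_mono) simp
  also have "\<dots> = a\<^sup>2" by (simp add: a_def power2_eq_square)
  also have "\<dots> \<le> 1" using a by (simp add: power_le_one)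
  finally have \<beta>1: "\<beta> \<le> 1" .
  have "2 * a * T z - T z \<le> L z - T z * V z"
    using entropy_vs_mean[OF z] T by (simp add: a_def power2_eq_square)
  then have "2 * (2 * a * T z - T z + T z * V z) + 2 * T z * ln (T z) - 2 * T z - T z * ln (var z) < 0"
    using gap by (simp add: entropy_gap_def algebra_simps)
  then have "T z * (4 * a - 4 + 2 * V z + 2 * ln (T z) - ln (var z)) < T z * 0"
    by (simp add: algebra_simps)
  then have "4 * a - 4 + 2 * V z + 2 * ln (T z) - ln (var z) < 0"
    using T mult_less_cancel_left_pos by blast
  moreover have "ln (f z / T z) = - V z - ln (T z)" using T by (simp add: ln_div) (simp add: f_def)
  ultimately have "- 4 * (1 - a) < ln \<beta>" using ln\<beta> by simp
  then have "exp (- 4 * (1 - a)) < exp (ln \<beta>)" unfolding exp_less_cancel_iff .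
  then have "exp (- 4 * (1 - a)) \<le> \<beta>" using \<beta>pos by simp
  from log_plus_ratio_le_one[OF a this \<beta>1]
  have "ln \<beta> + a\<^sup>2 / \<beta> \<le> 1" .
  moreover have "a\<^sup>2 / \<beta> = (S1 z / T z)\<^sup>2 / var z"
    using T vp less_imp_neq[OF f_pos[of z], symmetric] by (simp add: a_def \<beta>_def field_simps power2_eq_square)
  ultimately show ?thesis using ln\<beta> by simp
qed

lemma variance_le_exp_entropy:
  assumes x: "0 \<le> x" "x < b"
  shows "T x * ln (var x) \<le> 2 * L x + 2 * T x * ln (T x) - 2 * T x"
proof -
  have mono: "entropy_gap y \<le> entropy_gap x" if neg: "entropy_gap x < 0" and y: "x \<le> y" "y < b" for y
  proof (rule nonincreasing_from_right_derivative[where F = entropy_gap and c = 0])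
    fix z assume z: "x \<le> z" "z < y" "entropy_gap z < 0"
    have z': "0 \<le> z" "z < b" using z x y by auto
    have T: "0 < T z" using T_pos z' by simp
    have vp: "0 < var z" using var_pos z' by simp
    let ?D = "f z * (2 * ln (f z / T z) + ln (var z) + (S1 z / T z)\<^sup>2 / var z - 1)"
    have lnf: "ln (f z / T z) = - V z - ln (T z)" using T by (simp add: ln_div) (simp add: f_def)
    have "(entropy_gap has_real_derivative (2 * - (f z * V z) + (2 * - f z * ln (T z) + (1 / T z * - f z) * (2 * T z))
        - 2 * - f z - (- f z * ln (var z) + (1 / var z * (f z / T z * (var z - (S1 z / T z)\<^sup>2))) * T z))) (at_right z)"
      unfolding entropy_gap_def
      by (rule derivative_eq_intros der_right[OF z'] der_var[OF z'] refl T vp | simp)+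
    also have "(2 * - (f z * V z) + (2 * - f z * ln (T z) + (1 / T z * - f z) * (2 * T z))
        - 2 * - f z - (- f z * ln (var z) + (1 / var z * (f z / T z * (var z - (S1 z / T z)\<^sup>2))) * T z)) = ?D"
      unfolding lnf using T vp by (simp add: field_simps)
    finally have "(entropy_gap has_real_derivative ?D) (at_right z)" .
    moreover have "2 * ln (f z / T z) + ln (var z) + (S1 z / T z)\<^sup>2 / var z - 1 \<le> 0"
      using entropy_gap_slope_nonpos[OF z'] z(3) by simp
    ultimately show "\<exists>D\<le>0. (entropy_gap has_real_derivative D) (at_right z)"
      by (blast intro: mult_nonneg_nonpos f_nonneg)
  next
    have "0 < T z" "0 < var z" if "x \<le> z" "z \<le> y" for z
      using T_pos[of z] var_pos[of z] x y that by simp_all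
    then have nz: "T z \<noteq> 0" "2 * S2 z * T z - (S1 z)\<^sup>2 \<noteq> 0" if "x \<le> z" "z \<le> y" for z
      using that variance_pos[of z] x y by force+
    then show "continuous_on {x..y} entropy_gap"
      using x y unfolding entropy_gap_def var_def by (auto intro!: continuous_intros cont_on)
  qed fact+
  have "0 \<le> entropy_gap x"
  proof (rule ccontr)
    assume neg: "\<not> 0 \<le> entropy_gap x"
    define e where "e = - entropy_gap x"
    have e: "e > 0" using neg by (simp add: e_def)
    \<comment> \<open>The tail mass is the only variable in the lower bound near the end point.\<close>
    have lim: "((\<lambda>t::real. 2 * t * V 0 + 3 * (t * ln t) - 2 * t) \<longlongrightarrow> 0) (at_right 0)"
      by real_asymp
    then have "\<forall>\<^sub>F t in at_right 0. - e < 2 * t * V 0 + 3 * (t * ln t) - 2 * t"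
      using e by (intro order_tendstoD(1)) auto
    then obtain d where d: "0 < d" "\<And>t. 0 < t \<Longrightarrow> t < d \<Longrightarrow> - e < 2 * t * V 0 + 3 * (t * ln t) - 2 * t"
      unfolding eventually_at_right_field by auto
    obtain y where y: "x < y" "y < b" "T y < d" "2 * S2 y < 1" using T_small[OF x d(1)] .
    have "- e < entropy_gap y"
      using d(2)[of "T y"] T_pos[of y] entropy_gap_near_end[of y] x y by simp
    then show False using mono[of y] neg y by (simp add: e_def)
  qed
  then show ?thesis by (simp add: entropy_gap_def)
qed

lemma first_moment: "integral {0..b} (\<lambda>x. x * f x) = S1 0"
proof -
  have "((\<lambda>x. x * f x) has_integral - (S1 b + b * T b) - - (S1 0 + 0 * T 0)) {0..b}"
  proof (rule fundamental_theorem_of_calculus)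
    fix x assume x: "x \<in> {0..b}"
    show "((\<lambda>x. - (S1 x + x * T x)) has_vector_derivative x * f x) (at x within {0..b})"
      unfolding has_real_derivative_iff_has_vector_derivative[symmetric]
      by (rule derivative_eq_intros der_S1[OF x] der_T[OF x] refl)+ simp
  qed (use b_pos in simp)
  then show ?thesis by (simp add: integral_unique)
qed

lemma second_moment: "integral {0..b} (\<lambda>x. x\<^sup>2 * f x) = 2 * S2 0"
proof -
  have "((\<lambda>x. x\<^sup>2 * f x) has_integral - (2 * S2 b + 2 * b * S1 b + b\<^sup>2 * T b)
     - - (2 * S2 0 + 2 * 0 * S1 0 + 0\<^sup>2 * T 0)) {0..b}"
  proof (rule fundamental_theorem_of_calculus)
    fix x assume x: "x \<in> {0..b}"
    show "((\<lambda>x. - (2 * S2 x + 2 * x * S1 x + x\<^sup>2 * T x)) has_vector_derivative x\<^sup>2 * f x) (at x within {0..b})"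
      unfolding has_real_derivative_iff_has_vector_derivative[symmetric]
      by (rule derivative_eq_intros der_S1[OF x] der_T[OF x] der_S2[OF x] refl)+ (simp add: algebra_simps)
  qed (use b_pos in simp)
  then show ?thesis by (simp add: integral_unique)
qed

end

section \<open>Gluing the two sides of the mode\<close>

lemma two_minus_exp_le:
  fixes d :: real
  assumes "0 \<le> d"
  shows "(2 - d) * exp d \<le> 2 + d"
proof -
  have "(2 + 0) - (2 - 0) * exp 0 \<le> (2 + d) - (2 - d) * exp d"
  proof (rule DERIV_nonneg_imp_nondecreasing[OF assms])
    fix x :: real assume "0 \<le> x" "x \<le> d"
    have "(1 - x) * exp x \<le> exp (- x) * exp x"
      using exp_ge_add_one_self[of "- x"] by (intro mult_right_mono) auto
    then have "(1 - x) * exp x \<le> 1" by (simp flip: exp_add)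
    moreover have "((\<lambda>x. (2 + x) - (2 - x) * exp x) has_real_derivative 1 - (1 - x) * exp x) (at x)"
      by (auto intro!: derivative_eq_intros simp: algebra_simps)
    ultimately show "\<exists>D. ((\<lambda>x. (2 + x) - (2 - x) * exp x) has_real_derivative D) (at x) \<and> 0 \<le> D"
      by (intro exI[of _ "1 - (1 - x) * exp x"]) auto
  qed
  then show ?thesis by simp
qed

text \<open>
  Multiplied by \<open>exp (q * d)\<close>, this says that \<open>\<lambda>q. exp (q * d)\<close> dominates the cubic polynomial that agrees with it
  to first order at \<open>q = 0\<close> and at \<open>q = 1\<close>. It is proved by differentiating in \<open>d\<close>; there is equality at \<open>d = 0\<close>.
\<close>
lemma hermite_exp_nonneg:
  fixes p q d :: real
  assumes pq: "0 \<le> p" "0 \<le> q" "p + q = 1" and d: "0 \<le> d"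
  shows "p\<^sup>2 * (1 + 2 * q + q * d) * exp (- q * d) + q\<^sup>2 * (1 + 2 * p - p * d) * exp (p * d) \<le> 1"
proof -
  define \<phi> where "\<phi> d = p\<^sup>2 * (1 + 2 * q + q * d) * exp (- q * d) + q\<^sup>2 * (1 + 2 * p - p * d) * exp (p * d)" for d
  have q: "q = 1 - p" using pq by simp
  have "\<phi> d \<le> \<phi> 0"
  proof (rule DERIV_nonpos_imp_nonincreasing[OF d])
    fix x :: real assume x: "0 \<le> x" "x \<le> d"
    let ?D = "p\<^sup>2 * q\<^sup>2 * exp (- q * x) * ((2 - x) * exp x - (2 + x))"
    have e: "exp (p * x) = exp (- q * x) * exp x"
      unfolding exp_add[symmetric] q by (simp add: algebra_simps)
    have "(\<phi> has_real_derivative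
       (p\<^sup>2 * q * exp (- q * x) + p\<^sup>2 * (1 + 2 * q + q * x) * (exp (- q * x) * - q))
        + (q\<^sup>2 * - p * exp (p * x) + q\<^sup>2 * (1 + 2 * p - p * x) * (exp (p * x) * p))) (at x)"
      unfolding \<phi>_def by (auto intro!: derivative_eq_intros simp: algebra_simps)
    also have "(p\<^sup>2 * q * exp (- q * x) + p\<^sup>2 * (1 + 2 * q + q * x) * (exp (- q * x) * - q))
        + (q\<^sup>2 * - p * exp (p * x) + q\<^sup>2 * (1 + 2 * p - p * x) * (exp (p * x) * p))
       = p\<^sup>2 * q\<^sup>2 * exp (- q * x) * (- (2 + x)) + p\<^sup>2 * q\<^sup>2 * exp (p * x) * (2 - x)"
      unfolding q by (simp add: algebra_simps power2_eq_square)
    also have "\<dots> = ?D" unfolding e by (simp add: algebra_simps)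
    finally have "(\<phi> has_real_derivative ?D) (at x)" .
    moreover have "?D \<le> 0"
      using two_minus_exp_le[OF x(1)] by (intro mult_nonneg_nonpos) auto
    ultimately show "\<exists>D. (\<phi> has_real_derivative D) (at x) \<and> D \<le> 0" by blast
  qed
  also have "\<phi> 0 = 1" unfolding \<phi>_def q by (simp add: algebra_simps power2_eq_square)
  finally show ?thesis by (simp add: \<phi>_def)
qed

lemma hermite_exp:
  fixes p q d :: real
  assumes pq: "0 \<le> p" "0 \<le> q" "p + q = 1"
  shows "p\<^sup>2 * (1 + 2 * q + q * d) * exp (- q * d) + q\<^sup>2 * (1 + 2 * p - p * d) * exp (p * d) \<le> 1"
proof (cases "0 \<le> d")
  case True
  then show ?thesis by (rule hermite_exp_nonneg[OF pq])
next
  case False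
  then show ?thesis using hermite_exp_nonneg[of q p "- d"] pq by (simp add: algebra_simps)
qed

text \<open>
  The left-hand side is the variance of a log-concave density and the right-hand side its \<open>exp (2h - 2)\<close>, the unit of
  length being the ratio of the total mass to the maximum of the density. Here \<open>p\<close> and \<open>q\<close> are the masses to the right and to the left of the mode,
  \<open>s\<close> and \<open>t\<close> the entropy deficits of the two sides with respect to an exponential, \<open>a\<close>, \<open>a'\<close> their
  mean distances from the mode and \<open>\<beta>\<close>, \<open>\<beta>'\<close> their variances, each in units of the inverse hazard rate of that side at the mode. With \<open>d = 2 (s - t)\<close>,
  bounding \<open>a\<^sup>2\<close> by \<open>exp (- 2 s) (3 + d)\<close> and symmetrically \<open>a'\<^sup>2\<close> makes the left-hand side the Hermite polynomial of
  \<open>hermite_exp\<close>.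
\<close>
lemma two_sided_inequality:
  fixes p q s t a a' \<beta> \<beta>' :: real
  assumes pq: "0 \<le> p" "0 \<le> q" "p + q = 1"
    and s: "0 \<le> s" "s \<le> 1" and t: "0 \<le> t" "t \<le> 1"
    and a: "0 \<le> a" "a \<le> 1 - s / 2" and a': "0 \<le> a'" "a' \<le> 1 - t / 2"
    and \<beta>: "\<beta> \<le> exp (- 2 * s)" and \<beta>': "\<beta>' \<le> exp (- 2 * t)"
  shows "p ^ 3 * \<beta> + q ^ 3 * \<beta>' + p * q * (p * a + q * a')\<^sup>2 \<le> exp (- 2 * (p * s + q * t))"
proof -
  have sq: "x\<^sup>2 \<le> exp (- 2 * u) * (3 + 2 * u - 2 * w)"
    if "0 \<le> x" "x \<le> 1 - u / 2" "0 \<le> u" "u \<le> 1" "w \<le> 1" for x u w :: real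
  proof -
    have "x \<le> exp (- u / 2)" using exp_ge_add_one_self[of "- u / 2"] that by simp
    then have "x\<^sup>2 \<le> (exp (- u / 2))\<^sup>2" using that by (intro power_mono) auto
    also have "\<dots> = exp (- 2 * u) * exp u" by (simp add: power2_eq_square flip: exp_add)
    also have "\<dots> \<le> exp (- 2 * u) * (1 + 2 * u)"
      using exp_le_one_plus_double[of u] that by (intro mult_left_mono) auto
    also have "\<dots> \<le> exp (- 2 * u) * (3 + 2 * u - 2 * w)" using that by (intro mult_left_mono) auto
    finally show ?thesis .
  qed
  define X Y where "X = exp (- 2 * s)" and "Y = exp (- 2 * t)"
  define d where "d = 2 * (s - t)"
  define E where "E = exp (- 2 * (p * s + q * t))"
  have q: "q = 1 - p" using pq by simp
  have XE: "X = E * exp (- q * d)" "Y = E * exp (p * d)"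
    unfolding X_def Y_def E_def exp_add[symmetric] d_def q by (simp_all add: algebra_simps)
  have aX: "a\<^sup>2 \<le> X * (3 + d)" "a'\<^sup>2 \<le> Y * (3 - d)"
    using sq[of a s t] sq[of a' t s] s t a a' by (simp_all add: X_def Y_def d_def add_diff_eq diff_diff_eq2)
  have "p * a\<^sup>2 + q * a'\<^sup>2 - (p * a + q * a')\<^sup>2 = p * q * (a - a')\<^sup>2"
    unfolding q by (simp add: algebra_simps power2_eq_square)
  moreover have "0 \<le> p * q * (a - a')\<^sup>2" using pq by simp
  ultimately have "(p * a + q * a')\<^sup>2 \<le> p * a\<^sup>2 + q * a'\<^sup>2" by linarith
  also have "\<dots> \<le> p * (X * (3 + d)) + q * (Y * (3 - d))"
    using aX pq by (intro add_mono mult_left_mono) auto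
  finally have "p * q * (p * a + q * a')\<^sup>2 \<le> p * q * (p * (X * (3 + d)) + q * (Y * (3 - d)))"
    using pq by (intro mult_left_mono) auto
  moreover have "p ^ 3 * \<beta> \<le> p ^ 3 * X" "q ^ 3 * \<beta>' \<le> q ^ 3 * Y"
    using \<beta> \<beta>' pq by (auto intro!: mult_left_mono simp: X_def Y_def)
  ultimately have "p ^ 3 * \<beta> + q ^ 3 * \<beta>' + p * q * (p * a + q * a')\<^sup>2
     \<le> p ^ 3 * X + q ^ 3 * Y + p * q * (p * (X * (3 + d)) + q * (Y * (3 - d)))" by linarith
  also have "\<dots> = p\<^sup>2 * (1 + 2 * q + q * d) * X + q\<^sup>2 * (1 + 2 * p - p * d) * Y"
    unfolding q by (simp add: algebra_simps power2_eq_square power3_eq_cube)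
  also have "\<dots> = E * (p\<^sup>2 * (1 + 2 * q + q * d) * exp (- q * d) + q\<^sup>2 * (1 + 2 * p - p * d) * exp (p * d))"
    unfolding XE by (simp add: algebra_simps)
  also have "\<dots> \<le> E * 1" by (rule mult_left_mono[OF hermite_exp[OF pq]]) (simp add: E_def)
  finally show ?thesis by (simp add: E_def)
qed

text \<open>
  The results on one side of the mode, in scale-free parameters: \<open>s\<close> is the entropy deficit with respect to the exponential
  with the same initial hazard rate, and \<open>a\<close>, \<open>\<beta>\<close> are mean and variance in units of the inverse of that rate. The case
  \<open>B = 0\<close>, with \<open>T = 0\<close>, covers a mode at an end of the support.
\<close>
lemma half_line_parameters:
  fixes V :: "real \<Rightarrow> real" and B :: real
  assumes B: "0 \<le> B" and "convex_on {0..B} V" "mono_on {0..B} V" "continuous_on {0..B} V"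
  obtains T s a \<beta> where "0 \<le> T" "0 < B \<Longrightarrow> 0 < T" "0 \<le> s" "s \<le> 1" "0 \<le> a" "a \<le> 1 - s / 2" "\<beta> \<le> exp (- 2 * s)"
    "integral {0..B} (\<lambda>x. exp (- V x)) = T"
    "integral {0..B} (\<lambda>x. x * exp (- V x)) = a * T\<^sup>2 * exp (V 0)"
    "integral {0..B} (\<lambda>x. x\<^sup>2 * exp (- V x)) = (\<beta> + a\<^sup>2) * T ^ 3 * exp (V 0) ^ 2"
    "integral {0..B} (\<lambda>x. exp (- V x) * V x) = T * (1 - s + V 0)"
proof (cases "B = 0")
  case True
  show ?thesis by (rule that[of 0 0 0 1]) (simp_all add: True)
next
  case False
  interpret decreasing_log_concave V B
    by unfold_locales (use assms False in auto)
  have 0: "0 \<le> (0::real)" "0 < B" using b_pos by auto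
  have T: "0 < T 0" using T_pos[OF 0] .
  have S1: "0 < S1 0" using S1_pos[OF 0] .
  have F: "f 0 = 1 / exp (V 0)" by (simp add: f_def exp_minus field_simps)
  define s where "s = 1 - L 0 / T 0 + V 0"
  define a where "a = f 0 * S1 0 / (T 0)\<^sup>2"
  define \<beta> where "\<beta> = (f 0 / T 0)\<^sup>2 * var 0"
  have "0 \<le> s" using entropy_upper[OF 0] T by (simp add: s_def field_simps)
  moreover have "s \<le> 1" using entropy_lower[OF 0] T by (simp add: s_def field_simps)
  moreover have "0 \<le> a" using S1 by (simp add: a_def)
  moreover have "a \<le> 1 - s / 2"
  proof -
    have "(2 * f 0 * S1 0 / T 0 - T 0) / T 0 \<le> (L 0 - T 0 * V 0) / T 0"
      using entropy_vs_mean[OF 0] T by (intro divide_right_mono) auto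
    then show ?thesis using T by (simp add: s_def a_def diff_divide_distrib add_divide_distrib power2_eq_square)
  qed
  moreover have "\<beta> \<le> exp (- 2 * s)"
  proof -
    have vp: "0 < var 0" using var_pos[OF 0] .
    have "T 0 * ln (var 0) \<le> T 0 * (2 * (L 0 / T 0) + 2 * ln (T 0) - 2)"
      using variance_le_exp_entropy[OF 0] T by (simp add: algebra_simps)
    then have "ln (var 0) \<le> 2 * (L 0 / T 0) + 2 * ln (T 0) - 2" using T by simp
    moreover have "ln \<beta> = 2 * ln (f 0 / T 0) + ln (var 0)"
      using vp T less_imp_neq[OF f_pos[of 0]] by (simp add: \<beta>_def ln_mult ln_realpow)
    moreover have "ln (f 0 / T 0) = - V 0 - ln (T 0)" using T by (simp add: ln_div) (simp add: f_def)
    ultimately have "ln \<beta> \<le> - 2 * s" by (simp add: s_def)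
    moreover have "0 < \<beta>" unfolding \<beta>_def using vp T f_pos[of 0]
      by (intro mult_pos_pos zero_less_power divide_pos_pos)
    ultimately show ?thesis by (metis exp_le_cancel_iff exp_ln)
  qed
  moreover have "integral {0..B} (\<lambda>x. exp (- V x)) = T 0" by (simp add: T_def f_def[abs_def])
  moreover have "integral {0..B} (\<lambda>x. x * exp (- V x)) = a * (T 0)\<^sup>2 * exp (V 0)"
    using first_moment T by (simp add: f_def[abs_def] a_def) (simp add: exp_minus)
  moreover have "integral {0..B} (\<lambda>x. x\<^sup>2 * exp (- V x)) = (\<beta> + a\<^sup>2) * T 0 ^ 3 * exp (V 0) ^ 2"
  proof -
    have "(\<beta> + a\<^sup>2) * T 0 ^ 3 * exp (V 0) ^ 2 = 2 * S2 0"
      unfolding \<beta>_def a_def var_def F using T by (simp add: field_simps power2_eq_square power3_eq_cube)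
    then show ?thesis using second_moment by (simp add: f_def[abs_def])
  qed
  moreover have "integral {0..B} (\<lambda>x. exp (- V x) * V x) = T 0 * (1 - s + V 0)"
    using T by (simp add: L_def f_def[abs_def] s_def)
  ultimately show ?thesis using T that[of "T 0" s a \<beta>] by simp
qed

lemma integral_split_reflect:
  fixes g :: "real \<Rightarrow> real"
  assumes g: "continuous_on {a..b} g" and c: "a \<le> c" "c \<le> b"
  shows "integral {a..b} g = integral {0..b - c} (\<lambda>y. g (c + y)) + integral {0..c - a} (\<lambda>y. g (c - y))"
proof -
  have "integral {a..b} g = integral {a..c} g + integral {c..b} g"
    using Henstock_Kurzweil_Integration.integral_combine[OF c integrable_continuous_real[OF g]] by simp
  moreover have "integral {0..b - c} (\<lambda>y. g (c + y)) = integral {c..b} g"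
    using integral_shift_Icc_real[of 0 "b - c" g c] by (simp add: comp_def)
  moreover have "integral {0..c - a} (\<lambda>y. g (c - y)) = integral {a..c} g"
  proof -
    have "integral {0..c - a} (\<lambda>y. g (c - y)) = integral {-(c-a)..-0} (\<lambda>y. g (c + y))"
      using Henstock_Kurzweil_Integration.integral_reflect_real[of "c - a" 0 "\<lambda>y. g (c - y)"] by simp
    also have "\<dots> = integral {a..c} g"
      using integral_shift_Icc_real[of "a - c" 0 g c] by (simp add: comp_def)
    finally show ?thesis .
  qed
  ultimately show ?thesis by simp
qed

text \<open>
  In the normalised density the mean and the variance are \<open>M1 / T\<close> and \<open>M2 / T - (M1 / T)\<^sup>2\<close>, and the entropy is
  \<open>L / T + ln T\<close>.
\<close>
lemma variance_le_entropy_interval: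
  fixes V :: "real \<Rightarrow> real"
  assumes ab: "a < b" and cvx: "convex_on {a..b} V" and cont: "continuous_on {a..b} V"
  defines "T \<equiv> integral {a..b} (\<lambda>x. exp (- V x))"
    and "M1 \<equiv> integral {a..b} (\<lambda>x. x * exp (- V x))"
    and "M2 \<equiv> integral {a..b} (\<lambda>x. x\<^sup>2 * exp (- V x))"
    and "L \<equiv> integral {a..b} (\<lambda>x. exp (- V x) * V x)"
  shows "M2 / T - (M1 / T)\<^sup>2 \<le> exp (2 * (L / T + ln T) - 2)"
proof -
  \<comment> \<open>The mode: the minimum of V. The two sides are the functions V (c + y) and V (c - y).\<close>
  obtain c where c: "c \<in> {a..b}" "\<And>x. x \<in> {a..b} \<Longrightarrow> V c \<le> V x"
    using continuous_attains_inf[OF _ _ cont] ab by auto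
  have cc: "a \<le> c" "c \<le> b" using c by auto
  have mono: "mono_on {0..B} (\<lambda>y. V (c + e * y))"
    if B: "\<And>y. y \<in> {0..B} \<Longrightarrow> c + e * y \<in> {a..b}" for e B
  proof (rule mono_onI)
    fix y z assume yz: "y \<in> {0..B}" "z \<in> {0..B}" "y \<le> z"
    show "V (c + e * y) \<le> V (c + e * z)"
    proof (cases "z = 0")
      case True
      then show ?thesis using yz by simp
    next
      case False
      define t where "t = y / z"
      have t: "0 \<le> t" "t \<le> 1" and y: "y = t * z" using False yz by (auto simp: t_def divide_simps)
      have "c + e * y = (1 - t) *\<^sub>R c + t *\<^sub>R (c + e * z)" unfolding y by (simp add: algebra_simps)
      then have "V (c + e * y) \<le> (1 - t) * V c + t * V (c + e * z)"
        using convex_onD[OF cvx t c(1) B[OF yz(2)]] by simp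
      also have "\<dots> \<le> (1 - t) * V (c + e * z) + t * V (c + e * z)"
        using c(2)[OF B[OF yz(2)]] t by (intro add_mono mult_left_mono) auto
      finally show ?thesis by (simp add: algebra_simps)
    qed
  qed
  have cvx': "convex_on {0..B} (\<lambda>y. V (c + e * y))"
    if B: "\<And>y. y \<in> {0..B} \<Longrightarrow> c + e * y \<in> {a..b}" for e B
  proof (rule convex_onI)
    fix t y z :: real assume t: "0 < t" "t < 1" and yz: "y \<in> {0..B}" "z \<in> {0..B}"
    have "c + e * ((1 - t) *\<^sub>R y + t *\<^sub>R z) = (1 - t) *\<^sub>R (c + e * y) + t *\<^sub>R (c + e * z)"
      by (simp add: algebra_simps)
    then show "V (c + e * ((1 - t) *\<^sub>R y + t *\<^sub>R z)) \<le> (1 - t) * V (c + e * y) + t * V (c + e * z)"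
      using convex_onD[OF cvx _ _ B[OF yz(1)] B[OF yz(2)], of t] t by simp
  qed simp
  have cont': "continuous_on {0..B} (\<lambda>y. V (c + e * y))"
    if B: "\<And>y. y \<in> {0..B} \<Longrightarrow> c + e * y \<in> {a..b}" for e B
    by (rule continuous_on_compose2[OF cont]) (use B in \<open>auto intro!: continuous_intros\<close>)
  have B0: "0 \<le> b - c" "0 \<le> c - a" using cc by auto
  have B1: "c + 1 * y \<in> {a..b}" if "y \<in> {0..b - c}" for y using that cc by auto
  have B2: "c + (- 1) * y \<in> {a..b}" if "y \<in> {0..c - a}" for y using that cc by auto
  obtain T1 s a1 \<beta> where r: "0 \<le> T1" "0 < b - c \<Longrightarrow> 0 < T1" "0 \<le> s" "s \<le> 1" "0 \<le> a1" "a1 \<le> 1 - s / 2" "\<beta> \<le> exp (- 2 * s)"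
    "integral {0..b-c} (\<lambda>x. exp (- V (c + x))) = T1"
    "integral {0..b-c} (\<lambda>x. x * exp (- V (c + x))) = a1 * T1\<^sup>2 * exp (V c)"
    "integral {0..b-c} (\<lambda>x. x\<^sup>2 * exp (- V (c + x))) = (\<beta> + a1\<^sup>2) * T1 ^ 3 * exp (V c) ^ 2"
    "integral {0..b-c} (\<lambda>x. exp (- V (c + x)) * V (c + x)) = T1 * (1 - s + V c)"
    by (rule half_line_parameters[OF B0(1) cvx'[OF B1] mono[OF B1] cont'[OF B1], unfolded mult_1 add_0_right];
      (assumption | (rule that; (assumption | blast))))
  obtain T2 t a2 \<beta>' where l: "0 \<le> T2" "0 < c - a \<Longrightarrow> 0 < T2" "0 \<le> t" "t \<le> 1" "0 \<le> a2" "a2 \<le> 1 - t / 2" "\<beta>' \<le> exp (- 2 * t)"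
    "integral {0..c-a} (\<lambda>x. exp (- V (c - x))) = T2"
    "integral {0..c-a} (\<lambda>x. x * exp (- V (c - x))) = a2 * T2\<^sup>2 * exp (V c)"
    "integral {0..c-a} (\<lambda>x. x\<^sup>2 * exp (- V (c - x))) = (\<beta>' + a2\<^sup>2) * T2 ^ 3 * exp (V c) ^ 2"
    "integral {0..c-a} (\<lambda>x. exp (- V (c - x)) * V (c - x)) = T2 * (1 - t + V c)"
    by (rule half_line_parameters[OF B0(2) cvx'[OF B2] mono[OF B2] cont'[OF B2],
       unfolded mult_minus1 add_uminus_conv_diff diff_zero];
      (assumption | (rule that; (assumption | blast))))
  have T: "T = T1 + T2"
    unfolding T_def by (subst integral_split_reflect[OF _ cc]) (auto intro!: continuous_intros cont simp: r l)
  have Tpos: "0 < T" unfolding T using r(1,2) l(1,2) ab cc by (cases "c = a") auto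
  have L: "L = T1 * (1 - s + V c) + T2 * (1 - t + V c)"
    unfolding L_def by (subst integral_split_reflect[OF _ cc]) (auto intro!: continuous_intros cont simp: r l)
  define N1 where "N1 = (a1 * T1\<^sup>2 - a2 * T2\<^sup>2) * exp (V c)"
  define N2 where "N2 = ((\<beta> + a1\<^sup>2) * T1 ^ 3 + (\<beta>' + a2\<^sup>2) * T2 ^ 3) * exp (V c) ^ 2"
  have N1: "integral {a..b} (\<lambda>x. (x - c) * exp (- V x)) = N1"
    by (subst integral_split_reflect[OF _ cc])
      (auto intro!: continuous_intros cont simp: r l N1_def left_diff_distrib)
  have N2: "integral {a..b} (\<lambda>x. (x - c)\<^sup>2 * exp (- V x)) = N2"
    by (subst integral_split_reflect[OF _ cc])
      (auto intro!: continuous_intros cont simp: r l N2_def distrib_right)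
  have io: "(\<lambda>x. exp (- V x)) integrable_on {a..b}" "(\<lambda>x. (x - c) * exp (- V x)) integrable_on {a..b}"
    "(\<lambda>x. (x - c)\<^sup>2 * exp (- V x)) integrable_on {a..b}"
    by (auto intro!: integrable_continuous_real continuous_intros cont)
  have "M1 = integral {a..b} (\<lambda>x. (x - c) * exp (- V x) + c * exp (- V x))"
    unfolding M1_def by (simp add: algebra_simps)
  also have "\<dots> = N1 + c * T"
    using io by (simp add: integral_add integrable_on_mult_right N1 T_def)
  finally have M1: "M1 = N1 + c * T" .
  have "M2 = integral {a..b} (\<lambda>x. (x - c)\<^sup>2 * exp (- V x) + (2 * c * ((x - c) * exp (- V x)) + c\<^sup>2 * exp (- V x)))"
    unfolding M2_def by (intro arg_cong[where f = "integral {a..b}"]) (simp add: algebra_simps power2_eq_square fun_eq_iff)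
  also have "\<dots> = N2 + (2 * c * N1 + c\<^sup>2 * T)"
    using io by (simp add: integral_add integrable_on_mult_right integrable_add N1 N2 T_def)
  finally have M2: "M2 = N2 + (2 * c * N1 + c\<^sup>2 * T)" .
  have var: "M2 / T - (M1 / T)\<^sup>2 = N2 / T - (N1 / T)\<^sup>2"
    unfolding M1 M2 using Tpos by (simp add: field_simps power2_eq_square)
  define p q where "p = T1 / T" and "q = T2 / T"
  have pq: "0 \<le> p" "0 \<le> q" "p + q = 1"
    using Tpos r(1) l(1) by (auto simp: p_def q_def T simp flip: add_divide_distrib)
  have q: "q = 1 - p" using pq by simp
  have T12: "T1 = p * T" "T2 = q * T" using Tpos by (auto simp: p_def q_def)
  \<comment> \<open>The square of the length T / exp (- V c), which turns the parameters of each side into a variance.\<close>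
  define \<Lambda> where "\<Lambda> = (T * exp (V c))\<^sup>2"
  have "N2 / T - (N1 / T)\<^sup>2 = \<Lambda> * (p ^ 3 * (\<beta> + a1\<^sup>2) + q ^ 3 * (\<beta>' + a2\<^sup>2) - (p\<^sup>2 * a1 - q\<^sup>2 * a2)\<^sup>2)"
    unfolding N1_def N2_def T12 \<Lambda>_def using Tpos
    by (simp add: field_simps power2_eq_square power3_eq_cube)
  also have "p ^ 3 * (\<beta> + a1\<^sup>2) + q ^ 3 * (\<beta>' + a2\<^sup>2) - (p\<^sup>2 * a1 - q\<^sup>2 * a2)\<^sup>2
     = p ^ 3 * \<beta> + q ^ 3 * \<beta>' + p * q * (p * a1 + q * a2)\<^sup>2"
    unfolding q by (simp add: algebra_simps power2_eq_square power3_eq_cube)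
  also have "\<Lambda> * \<dots> \<le> \<Lambda> * exp (- 2 * (p * s + q * t))"
    using two_sided_inequality[OF pq r(3,4) l(3,4) r(5,6) l(5,6) r(7) l(7)]
    by (intro mult_left_mono) (auto simp: \<Lambda>_def)
  also have "\<Lambda> = exp (2 * (ln T + V c))"
    using Tpos by (simp add: \<Lambda>_def exp_add exp_double power_mult_distrib)
  also have "exp (2 * (ln T + V c)) * exp (- 2 * (p * s + q * t)) = exp (2 * (L / T + ln T) - 2)"
  proof -
    have "L / T = p * (1 - s + V c) + q * (1 - t + V c)"
      unfolding L p_def q_def by (simp add: add_divide_distrib)
    also have "\<dots> = (p + q) * (1 + V c) - (p * s + q * t)" by (simp add: algebra_simps)
    finally have LT: "L / T = 1 + V c - (p * s + q * t)" unfolding pq(3) by simp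
    have "2 * (ln T + V c) + - 2 * (p * s + q * t) = 2 * (L / T + ln T) - 2"
      unfolding LT by (simp add: algebra_simps)
    then show ?thesis by (simp only: exp_add[symmetric])
  qed
  finally show ?thesis unfolding var .
qed

section \<open>From intervals to arbitrary log-concave densities\<close>

lemma exp_minus_nonneg[simp]: "0 \<le> exp_minus v"
  by (simp add: exp_minus_def)

lemma ereal_convexD:
  assumes "ereal_convex W" "W x < \<infinity>" "W y < \<infinity>" "0 \<le> t" "t \<le> 1"
  shows "W ((1 - t) * x + t * y) < \<infinity>"
    "real_of_ereal (W ((1 - t) * x + t * y)) \<le> (1 - t) * real_of_ereal (W x) + t * real_of_ereal (W y)"
proof -
  have fin: "W x \<noteq> -\<infinity>" "W y \<noteq> -\<infinity>" "W ((1 - t) * x + t * y) \<noteq> -\<infinity>"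
    using assms(1) by (auto simp: ereal_convex_def)
  obtain a where a: "W x = ereal a" using fin assms(2) by (cases "W x") auto
  obtain b where b: "W y = ereal b" using fin assms(3) by (cases "W y") auto
  have le: "W ((1 - t) * x + t * y) \<le> ereal ((1 - t) * a + t * b)"
    using assms(1,4,5) a b unfolding ereal_convex_def by (metis times_ereal.simps(1) plus_ereal.simps(1))
  then show "W ((1 - t) * x + t * y) < \<infinity>" by (auto intro: le_less_trans)
  show "real_of_ereal (W ((1 - t) * x + t * y)) \<le> (1 - t) * real_of_ereal (W x) + t * real_of_ereal (W y)"
    using le fin(3) a b by (cases "W ((1 - t) * x + t * y)") auto
qed

text \<open>
  The set where \<open>W\<close> is finite is convex, hence an interval. It differs from its interior, on which \<open>W\<close> is continuous,
  in at most two points.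
\<close>
lemma log_concave_density_support:
  assumes W: "ereal_convex W" and int: "(\<integral>x. exp_minus (W x) \<partial>lborel) \<noteq> 0"
  obtains a b :: ereal where "a < b" "\<And>x. x \<in> einterval a b \<Longrightarrow> W x < \<infinity>"
    "AE x in lborel. x \<notin> einterval a b \<longrightarrow> exp_minus (W x) = 0"
    "convex_on (einterval a b) (\<lambda>x. real_of_ereal (W x))"
proof -
  define D where "D = {x. W x < \<infinity>}"
  define a b where "a = (INF x\<in>D. ereal x)" and "b = (SUP x\<in>D. ereal x)"
  have fin: "AE x in lborel. x \<notin> {real_of_ereal a, real_of_ereal b}"
    by (rule AE_not_in) (simp add: finite_imp_null_set_lborel)
  have bnd: "a \<le> ereal x" "ereal x \<le> b" if "x \<in> D" for x
    using that unfolding a_def b_def by (auto intro: INF_lower SUP_upper)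
  have out: "x \<in> einterval a b \<or> x \<in> {real_of_ereal a, real_of_ereal b}" if "x \<in> D" for x
    using bnd[OF that] by (auto simp: einterval_def less_le)
  have AE: "AE x in lborel. x \<notin> einterval a b \<longrightarrow> exp_minus (W x) = 0"
    using fin by eventually_elim (use out in \<open>auto simp: D_def exp_minus_def\<close>)
  have "a < b"
  proof (rule ccontr)
    assume "\<not> a < b"
    then have "einterval a b = {}" by (auto simp: einterval_def)
    then have "AE x in lborel. exp_minus (W x) = 0" using AE by simp
    then have "(\<integral>x. exp_minus (W x) \<partial>lborel) = 0" by (rule integral_eq_zero_AE)
    then show False using int by simp
  qed
  have sub: "x \<in> D" if xin: "x \<in> einterval a b" for x
  proof -
    obtain y z where yz: "y \<in> D" "z \<in> D" "y < x" "x < z"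
      using xin unfolding einterval_def a_def b_def by (auto simp: INF_less_iff less_SUP_iff)
    define t where "t = (x - y) / (z - y)"
    have t: "0 \<le> t" "t \<le> 1" using yz by (auto simp: t_def)
    have "t * (z - y) = x - y" using yz by (simp add: t_def)
    then have "x = (1 - t) * y + t * z" by (simp add: algebra_simps)
    then show ?thesis using ereal_convexD(1)[OF W _ _ t, of y z] yz by (simp add: D_def)
  qed
  have conv: "convex (einterval a b)"
    unfolding is_interval_convex_1[symmetric] is_interval_1 einterval_def
    by (auto) (metis ereal_less_eq(3) less_le_trans, metis ereal_less_eq(3) le_less_trans)
  have "convex_on (einterval a b) (\<lambda>x. real_of_ereal (W x))"
    by (rule convex_onI[OF _ conv]) (use ereal_convexD(2)[OF W] sub in \<open>auto simp: D_def\<close>)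
  with \<open>a < b\<close> sub AE show ?thesis using that by (simp add: D_def)
qed

text \<open>
  Fix an interval \<open>[l, u]\<close> on which the density is at least \<open>exp (- C)\<close>. If it had a large value at \<open>x\<close>, it would be at
  least the geometric mean of this value and \<open>exp (- C)\<close> at all midpoints between \<open>x\<close> and \<open>[l, u]\<close>, and these have measure
  \<open>(u - l) / 2\<close>.
\<close>
lemma log_concave_density_bounded:
  assumes W: "ereal_convex W" and int: "integrable lborel (\<lambda>x. exp_minus (W x))"
    and one: "(\<integral>x. exp_minus (W x) \<partial>lborel) = 1"
  obtains K where "\<And>x. exp_minus (W x) \<le> K"
proof -
  have "(\<integral>x. exp_minus (W x) \<partial>lborel) \<noteq> 0" using one by simp
  then obtain a b where ab: "a < b" "\<And>x. x \<in> einterval a b \<Longrightarrow> W x < \<infinity>"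
    by (rule log_concave_density_support[OF W]) (rule that; blast)
  obtain l where l: "a < ereal l" "ereal l < b" using ereal_dense2[OF ab(1)] by auto
  obtain u where u: "ereal l < ereal u" "ereal u < b" using ereal_dense2[OF l(2)] by auto
  have lu: "l < u" using u by simp
  have fin: "W l < \<infinity>" "W u < \<infinity>"
    using ab(2) l u less_trans[OF l(1) u(1)] by (auto simp: einterval_def)
  define C where "C = max (real_of_ereal (W l)) (real_of_ereal (W u))"
  have C: "W y < \<infinity> \<and> real_of_ereal (W y) \<le> C" if "y \<in> {l..u}" for y
  proof -
    define t where "t = (y - l) / (u - l)"
    have t: "0 \<le> t" "t \<le> 1" using that lu by (auto simp: t_def)
    have "t * (u - l) = y - l" using lu by (simp add: t_def)
    then have y: "y = (1 - t) * l + t * u" by (simp add: algebra_simps)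
    have "real_of_ereal (W y) \<le> (1 - t) * real_of_ereal (W l) + t * real_of_ereal (W u)"
      unfolding y by (rule ereal_convexD[OF W fin t])
    also have "\<dots> \<le> (1 - t) * C + t * C"
      using t by (intro add_mono mult_left_mono) (auto simp: C_def)
    also have "\<dots> = C" by (simp add: left_diff_distrib)
    finally show ?thesis using ereal_convexD(1)[OF W fin t, folded y] by simp
  qed
  have "exp_minus (W x) \<le> exp C * (2 / (u - l)) ^ 2" for x
  proof (cases "W x < \<infinity>")
    case False
    then show ?thesis by (simp add: exp_minus_def)
  next
    case True
    define v where "v = real_of_ereal (W x)"
    define S where "S = {(x + l) / 2..(x + u) / 2}"
    have low: "exp (- (v + C) / 2) \<le> exp_minus (W z)" if "z \<in> S" for z
    proof -
      define w where "w = 2 * z - x"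
      have w: "w \<in> {l..u}" using that by (auto simp: S_def w_def)
      have z: "(1 - 1 / 2) * x + 1 / 2 * w = z" by (simp add: w_def field_simps)
      have Cw: "W w < \<infinity>" "real_of_ereal (W w) \<le> C" using C[OF w] by auto
      note mid = ereal_convexD[OF W True Cw(1), of "1 / 2", unfolded z]
      have 1: "W z < \<infinity>" by (rule mid(1)) auto
      have "real_of_ereal (W z) \<le> (1 - 1 / 2) * v + 1 / 2 * real_of_ereal (W w)"
        unfolding v_def by (rule mid(2)) auto
      also have "\<dots> \<le> (v + C) / 2" using Cw(2) by simp
      finally show ?thesis using 1 by (auto simp: exp_minus_def)
    qed
    have "integrable lborel (indicator S :: real \<Rightarrow> real)"
      unfolding S_def by (rule integrable_real_indicator) (auto simp: emeasure_lborel_Icc_eq)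
    then have "(\<integral>z. exp (- (v + C) / 2) * indicator S z \<partial>lborel) \<le> (\<integral>z. exp_minus (W z) \<partial>lborel)"
      using low by (intro integral_mono int) (auto split: split_indicator)
    moreover have "measure lborel S = (u - l) / 2"
      using lu unfolding S_def by (subst measure_lborel_Icc) (simp_all add: field_simps)
    ultimately have "exp (- (v + C) / 2) * ((u - l) / 2) \<le> 1" using one by simp
    then have "exp (- (v + C) / 2) \<le> 2 / (u - l)" using lu by (simp add: field_simps)
    then have "exp (- (v + C) / 2) ^ 2 \<le> (2 / (u - l)) ^ 2" by (intro power_mono) auto
    moreover have "exp (- (v + C) / 2) ^ 2 = exp (- v) * exp (- C)"
      by (simp add: power2_eq_square flip: exp_add)
    ultimately have "exp (- v) * exp (- C) * exp C \<le> (2 / (u - l)) ^ 2 * exp C"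
      by (intro mult_right_mono) auto
    also have "exp (- v) * exp (- C) * exp C = exp (- v)" by (simp flip: exp_add)
    finally have "exp (- v) \<le> exp C * (2 / (u - l)) ^ 2" by (simp only: mult.commute)
    then show ?thesis using True by (auto simp: exp_minus_def v_def)
  qed
  then show ?thesis using that by blast
qed

text \<open>
  The exponential has the least entropy among log-concave densities of given variance. All quantities in
  \<open>variance_le_entropy_interval\<close> converge along compact intervals that exhaust the interior of the support.
\<close>
lemma log_concave_variance_le_entropy:
  fixes W :: "real \<Rightarrow> ereal"
  defines "f \<equiv> \<lambda>x. exp_minus (W x)"
  assumes W: "ereal_convex W" and int: "integrable lborel f" and one: "(\<integral>x. f x \<partial>lborel) = 1"
    and int2: "integrable lborel (\<lambda>x. x\<^sup>2 * f x)" and int1: "integrable lborel (\<lambda>x. x * f x)"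
    and intL: "integrable lborel (\<lambda>x. f x * ln (f x))"
  shows "(\<integral>x. x\<^sup>2 * f x \<partial>lborel) - (\<integral>x. x * f x \<partial>lborel)\<^sup>2 \<le> exp (2 * (- (\<integral>x. f x * ln (f x) \<partial>lborel)) - 2)"
proof -
  have "(\<integral>x. exp_minus (W x) \<partial>lborel) \<noteq> 0" using one by (simp add: f_def)
  then obtain a b where ab: "a < b" "\<And>x. x \<in> einterval a b \<Longrightarrow> W x < \<infinity>"
    "AE x in lborel. x \<notin> einterval a b \<longrightarrow> exp_minus (W x) = 0"
    "convex_on (einterval a b) (\<lambda>x. real_of_ereal (W x))"
    by (rule log_concave_density_support[OF W]) (rule that; blast)
  define V where "V x = real_of_ereal (W x)" for x
  obtain u l where lu: "einterval a b = (\<Union>i. {l i .. u i})" "incseq u" "decseq l" "\<And>i. l i < u i"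
    by (rule einterval_Icc_approximation[OF ab(1)]) (rule that; assumption)
  have sub: "{l n..u n} \<subseteq> einterval a b" for n unfolding lu(1) by (rule UN_upper) simp
  have cvx: "convex_on {l n..u n} V" for n
    using ab(4) sub[of n] unfolding V_def[abs_def] by (rule convex_on_subset) simp
  have "continuous_on (einterval a b) V"
    by (rule convex_on_continuous) (use ab(4) in \<open>auto simp: V_def[abs_def]\<close>)
  then have cont: "continuous_on {l n..u n} V" for n
    by (rule continuous_on_subset) (rule sub)
  have fV: "f x = exp (- V x)" if "x \<in> einterval a b" for x
    using ab(2)[OF that] by (auto simp: f_def exp_minus_def V_def)
  have lim: "(\<lambda>n. integral {l n..u n} g') \<longlonglongrightarrow> (\<integral>x. g x \<partial>lborel)"
    if g: "integrable lborel g" "\<And>x. f x = 0 \<Longrightarrow> g x = 0" "\<And>x. x \<in> einterval a b \<Longrightarrow> g x = g' x"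
      and g': "\<And>n. continuous_on {l n..u n} g'" for g g' :: "real \<Rightarrow> real"
  proof -
    have "integral {l n..u n} g' = (\<integral>x. indicator {l n..u n} x * g x \<partial>lborel)" for n
    proof -
      have "integral {l n..u n} g' = (LINT x:{l n..u n}|lborel. g' x)"
        using borel_integrable_atLeastAtMost'[OF g'[of n]] by (rule set_borel_integral_eq_integral(2)[symmetric])
      also have "\<dots> = (\<integral>x. indicator {l n..u n} x * g x \<partial>lborel)"
        unfolding set_lebesgue_integral_def using g(3) sub[of n]
        by (intro Bochner_Integration.integral_cong) (auto split: split_indicator)
      finally show ?thesis .
    qed
    moreover have "(\<lambda>n. \<integral>x. indicator {l n..u n} x * g x \<partial>lborel) \<longlonglongrightarrow> (\<integral>x. g x \<partial>lborel)"
    proof (rule integral_dominated_convergence[where w = "\<lambda>x. norm (g x)"])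
      show "AE x in lborel. (\<lambda>n. indicator {l n..u n} x * g x) \<longlonglongrightarrow> g x"
        using ab(3)
      proof eventually_elim
        case (elim x)
        show ?case
        proof (cases "x \<in> einterval a b")
          case True
          then obtain i where i: "x \<in> {l i..u i}" using lu(1) by auto
          have "x \<in> {l n..u n}" if "n \<ge> i" for n
            using i incseqD[OF lu(2) that] decseqD[OF lu(3) that] by auto
          then have "\<forall>\<^sub>F n in sequentially. indicator {l n..u n} x * g x = g x"
            by (intro eventually_sequentiallyI[of i]) auto
          then show ?thesis by (rule tendsto_eventually)
        next
          case False
          then have "g x = 0" using elim g(2) by (simp add: f_def)
          then show ?thesis by simp
        qed
      qed
    qed (use g(1) in \<open>auto split: split_indicator\<close>)
    ultimately show ?thesis by simp
  qed
  define T M1 M2 L where "T n = integral {l n..u n} (\<lambda>x. exp (- V x))"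
    and "M1 n = integral {l n..u n} (\<lambda>x. x * exp (- V x))"
    and "M2 n = integral {l n..u n} (\<lambda>x. x\<^sup>2 * exp (- V x))"
    and "L n = integral {l n..u n} (\<lambda>x. exp (- V x) * V x)" for n
  have T: "T \<longlonglongrightarrow> 1"
    unfolding T_def[abs_def] one[symmetric]
    by (rule lim[OF int]) (auto simp: fV intro!: continuous_intros cont)
  have M1: "M1 \<longlonglongrightarrow> (\<integral>x. x * f x \<partial>lborel)"
    unfolding M1_def[abs_def]
    by (rule lim[OF int1]) (auto simp: fV intro!: continuous_intros cont)
  have M2: "M2 \<longlonglongrightarrow> (\<integral>x. x\<^sup>2 * f x \<partial>lborel)"
    unfolding M2_def[abs_def]
    by (rule lim[OF int2]) (auto simp: fV intro!: continuous_intros cont)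
  have "L \<longlonglongrightarrow> (\<integral>x. - (f x * ln (f x)) \<partial>lborel)"
    unfolding L_def[abs_def]
    by (rule lim[OF integrable_minus[OF intL]]) (auto simp: fV intro!: continuous_intros cont)
  then have L: "L \<longlonglongrightarrow> - (\<integral>x. f x * ln (f x) \<partial>lborel)" by simp
  have A: "(\<lambda>n. M2 n / T n - (M1 n / T n)\<^sup>2) \<longlonglongrightarrow> (\<integral>x. x\<^sup>2 * f x \<partial>lborel) / 1 - ((\<integral>x. x * f x \<partial>lborel) / 1)\<^sup>2"
    by (intro tendsto_intros T M1 M2) auto
  have B: "(\<lambda>n. exp (2 * (L n / T n + ln (T n)) - 2))
     \<longlonglongrightarrow> exp (2 * (- (\<integral>x. f x * ln (f x) \<partial>lborel) / 1 + ln 1) - 2)"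
    by (intro tendsto_intros T L) auto
  have C: "M2 n / T n - (M1 n / T n)\<^sup>2 \<le> exp (2 * (L n / T n + ln (T n)) - 2)" for n
    unfolding T_def M1_def M2_def L_def by (rule variance_le_entropy_interval[OF lu(4) cvx cont])
  from LIMSEQ_le[OF A B] C show ?thesis by simp
qed

section \<open>Entropy of bounded densities\<close>

text \<open>
  Boundedness and the second moment make the entropy integral converge. The class is closed under adding an
  independent square-integrable variable.
\<close>
definition regular_density :: "(real \<Rightarrow> real) \<Rightarrow> bool" where
  "regular_density f \<longleftrightarrow> f \<in> borel_measurable borel \<and> (\<forall>x. 0 \<le> f x) \<and> (\<exists>K. \<forall>x. f x \<le> K) \<and>
     integrable lborel f \<and> (\<integral>x. f x \<partial>lborel) = 1 \<and> integrable lborel (\<lambda>x. x\<^sup>2 * f x)"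

definition density_entropy :: "(real \<Rightarrow> real) \<Rightarrow> real" where
  "density_entropy f = - (\<integral>x. f x * ln (f x) \<partial>lborel)"

lemma regular_densityD:
  assumes "regular_density f"
  shows "f \<in> borel_measurable borel" "0 \<le> f x" "integrable lborel f" "(\<integral>x. f x \<partial>lborel) = 1"
    "integrable lborel (\<lambda>x. x\<^sup>2 * f x)"
  using assms by (auto simp: regular_density_def)

lemma regular_density_first_moment:
  assumes f: "regular_density f"
  shows "integrable lborel (\<lambda>x. x * f x)"
proof (rule Bochner_Integration.integrable_bound)
  note [measurable] = regular_densityD(1)[OF f]
  show "integrable lborel (\<lambda>x. f x + x\<^sup>2 * f x)" using regular_densityD[OF f] by simp
  show "(\<lambda>x. x * f x) \<in> borel_measurable lborel" by measurable
  have "\<bar>x\<bar> \<le> 1 + x\<^sup>2" for x :: real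
    using zero_le_power2[of "\<bar>x\<bar> - 1"] by (simp add: power2_eq_square algebra_simps)
  then show "AE x in lborel. norm (x * f x) \<le> norm (f x + x\<^sup>2 * f x)"
  proof (intro AE_I2)
    fix x
    assume "\<And>x::real. \<bar>x\<bar> \<le> 1 + x\<^sup>2"
    then have "\<bar>x\<bar> * f x \<le> (1 + x\<^sup>2) * f x" using regular_densityD(2)[OF f] by (intro mult_right_mono) auto
    then show "norm (x * f x) \<le> norm (f x + x\<^sup>2 * f x)"
      using regular_densityD(2)[OF f, of x] by (simp add: abs_mult algebra_simps)
  qed
qed

lemma regular_density_quadratic:
  assumes f: "regular_density f"
  shows "integrable lborel (\<lambda>x. f x * (x - m)\<^sup>2)"
proof -
  have "integrable lborel (\<lambda>x. x\<^sup>2 * f x - 2 * m * (x * f x) + m\<^sup>2 * f x)"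
    using regular_densityD[OF f] regular_density_first_moment[OF f] by auto
  then show ?thesis by (simp add: power2_eq_square algebra_simps)
qed

lemma ln_normal_density:
  assumes "0 < \<tau>"
  shows "ln (normal_density m \<tau> x) = - (1 / 2 * ln (2 * pi * \<tau>\<^sup>2)) - (x - m)\<^sup>2 / (2 * \<tau>\<^sup>2)"
  using assms by (simp add: normal_density_def ln_mult ln_div ln_sqrt)

lemma integral_ln_normal_density:
  assumes f: "regular_density f" and "0 < \<tau>"
  shows "integrable lborel (\<lambda>x. f x * ln (normal_density m \<tau> x))"
    "(\<integral>x. f x * ln (normal_density m \<tau> x) \<partial>lborel) =
      - (1 / 2 * ln (2 * pi * \<tau>\<^sup>2)) - (\<integral>x. f x * (x - m)\<^sup>2 \<partial>lborel) / (2 * \<tau>\<^sup>2)"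
proof -
  have eq: "(\<lambda>x. f x * ln (normal_density m \<tau> x)) =
    (\<lambda>x. - (1 / 2 * ln (2 * pi * \<tau>\<^sup>2)) * f x - f x * (x - m)\<^sup>2 / (2 * \<tau>\<^sup>2))"
    unfolding ln_normal_density[OF assms(2)] by (simp add: algebra_simps)
  note i = regular_densityD(3)[OF f] regular_density_quadratic[OF f, of m]
  show "integrable lborel (\<lambda>x. f x * ln (normal_density m \<tau> x))"
    unfolding eq using i by auto
  show "(\<integral>x. f x * ln (normal_density m \<tau> x) \<partial>lborel) =
      - (1 / 2 * ln (2 * pi * \<tau>\<^sup>2)) - (\<integral>x. f x * (x - m)\<^sup>2 \<partial>lborel) / (2 * \<tau>\<^sup>2)"
    unfolding eq using i by (subst Bochner_Integration.integral_diff) (simp_all add: regular_densityD(4)[OF f])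
qed

text \<open>
  The tangent inequality for \<open>x ln x\<close>, scaled. Integrated, it gives the nonnegativity of relative entropy; it avoids
  division by \<open>f\<close>.
\<close>
lemma mult_ln_ge:
  fixes f g :: real
  assumes "0 \<le> f" "0 < g"
  shows "f * ln g + f - g \<le> f * ln f"
proof (cases "f = 0")
  case False
  then have f: "0 < f" using assms by simp
  have "ln (g / f) \<le> g / f - 1" using f assms by (intro ln_le_minus_one) simp
  then have "f * ln (g / f) \<le> f * (g / f - 1)" using f by (intro mult_left_mono) auto
  then show ?thesis using f assms by (simp add: ln_div algebra_simps)
qed (use assms in simp)

text \<open>
  The upper bound on \<open>f\<close> controls the positive part of \<open>f ln f\<close>; comparison with a Gaussian density controls the negative part.
\<close>
lemma regular_density_entropy_integrable:
  assumes f: "regular_density f"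
  shows "integrable lborel (\<lambda>x. f x * ln (f x))"
proof -
  note [measurable] = regular_densityD(1)[OF f]
  note D = regular_densityD[OF f]
  obtain K0 where K0: "\<And>x. f x \<le> K0" using f by (auto simp: regular_density_def)
  define K where "K = max 1 K0"
  have K: "1 \<le> K" "\<And>x. f x \<le> K"
    using order_trans[OF K0 max.cobounded2] by (auto simp: K_def)
  let ?w = "\<lambda>x. f x * ln K + \<bar>f x * ln (std_normal_density x)\<bar> + std_normal_density x"
  show ?thesis
  proof (rule Bochner_Integration.integrable_bound)
    show "integrable lborel ?w"
      using D integral_ln_normal_density(1)[OF f, of 1 0] by (intro Bochner_Integration.integrable_add integrable_abs) auto
    show "(\<lambda>x. f x * ln (f x)) \<in> borel_measurable lborel" by measurable
    show "AE x in lborel. norm (f x * ln (f x)) \<le> norm (?w x)"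
    proof (rule AE_I2)
      fix x
      have lnK: "0 \<le> ln K" using K by simp
      have up: "f x * ln (f x) \<le> f x * ln K"
        using K D(2)[of x] by (cases "f x = 0") (auto intro!: mult_left_mono)
      have "f x * ln (std_normal_density x) + f x - std_normal_density x \<le> f x * ln (f x)"
        using D(2) by (intro mult_ln_ge) (auto simp: normal_density_pos)
      then have low: "- \<bar>f x * ln (std_normal_density x)\<bar> - std_normal_density x \<le> f x * ln (f x)"
        using D(2)[of x] by linarith
      have 1: "0 \<le> f x * ln K" using lnK D(2) by simp
      have 2: "0 \<le> std_normal_density x" by simp
      show "norm (f x * ln (f x)) \<le> norm (?w x)"
        unfolding real_norm_def using up low 1 2 by linarith
    qed
  qed
qed

text \<open>
  For \<open>\<tau>\<^sup>2\<close> the variance and \<open>m\<close> the mean of \<open>f\<close>, the right-hand side is the entropy of the Gaussian with these parameters.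
\<close>
lemma density_entropy_le_gaussian:
  assumes f: "regular_density f" and \<tau>: "0 < \<tau>"
  shows "density_entropy f \<le> 1 / 2 * ln (2 * pi * \<tau>\<^sup>2) + (\<integral>x. f x * (x - m)\<^sup>2 \<partial>lborel) / (2 * \<tau>\<^sup>2)"
proof -
  note D = regular_densityD[OF f]
  have i: "integrable lborel (\<lambda>x. f x * ln (normal_density m \<tau> x) + f x - normal_density m \<tau> x)"
    using integral_ln_normal_density(1)[OF f \<tau>, of m] D(3) \<tau> by auto
  have "(\<integral>x. f x * ln (normal_density m \<tau> x) + f x - normal_density m \<tau> x \<partial>lborel) \<le> (\<integral>x. f x * ln (f x) \<partial>lborel)"
    by (rule integral_mono[OF i regular_density_entropy_integrable[OF f]])
      (use D(2) \<tau> in \<open>auto intro!: mult_ln_ge simp: normal_density_pos\<close>)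
  also have "(\<integral>x. f x * ln (normal_density m \<tau> x) + f x - normal_density m \<tau> x \<partial>lborel)
     = (\<integral>x. f x * ln (normal_density m \<tau> x) \<partial>lborel)"
    using integral_ln_normal_density(1)[OF f \<tau>, of m] D \<tau>
    by (subst Bochner_Integration.integral_diff, auto)+
  finally show ?thesis unfolding integral_ln_normal_density(2)[OF f \<tau>] density_entropy_def by simp
qed

lemma differential_entropy_eq:
  assumes "prob_space \<Omega>" "distributed \<Omega> lborel Y (\<lambda>x. ennreal (g x))" "\<And>x. 0 \<le> g x"
  shows "differential_entropy \<Omega> Y = density_entropy g"
proof -
  interpret prob_space \<Omega> by fact
  interpret information_space \<Omega> "exp 1" by unfold_locales simp
  show ?thesis
    unfolding differential_entropy_def density_entropy_def
    by (subst entropy_distr[OF assms(2)]) (auto simp: assms(3) log_def)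
qed

text \<open>
  The density of the sum at \<open>z\<close> is the average of \<open>f (z - x)\<close> over the law of \<open>X\<close>; averages keep the bound \<open>K\<close>.
\<close>
lemma sum_density:
  fixes \<Omega> :: "'c measure" and X Y :: "'c \<Rightarrow> real" and f :: "real \<Rightarrow> real"
  assumes "prob_space \<Omega>" and ind: "prob_space.indep_var \<Omega> borel X borel Y"
    and Y: "distributed \<Omega> lborel Y (\<lambda>x. ennreal (f x))"
    and f[measurable]: "f \<in> borel_measurable borel" and f0: "\<And>x. 0 \<le> f x" and fK: "\<And>x. f x \<le> K"
    and g: "\<And>z. g z = (\<integral>x. f (z - x) \<partial>distr \<Omega> borel X)"
  shows "distributed \<Omega> lborel (\<lambda>\<omega>. X \<omega> + Y \<omega>) (\<lambda>x. ennreal (g x))"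
    "g \<in> borel_measurable borel" "0 \<le> g z" "g z \<le> K"
proof -
  interpret prob_space \<Omega> by fact
  have rv[measurable]: "X \<in> borel_measurable \<Omega>" "Y \<in> borel_measurable \<Omega>"
    using ind by (auto dest: indep_var_rv1 indep_var_rv2)
  define \<mu> where "\<mu> = distr \<Omega> borel X"
  have "prob_space \<mu>" unfolding \<mu>_def by (rule prob_space_distr) simp
  then interpret \<mu>: prob_space \<mu> .
  have s\<mu>[measurable_cong, simp]: "sets \<mu> = sets borel" and sp\<mu>[simp]: "space \<mu> = UNIV" by (simp_all add: \<mu>_def)
  interpret pm: pair_sigma_finite \<mu> lborel ..
  have int: "integrable \<mu> (\<lambda>x. f (z - x))" for z
    by (rule \<mu>.integrable_const_bound[where B = K]) (use f0 fK in auto)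
  have gz: "g z = (\<integral>x. f (z - x) \<partial>\<mu>)" for z by (simp add: g \<mu>_def)
  show gm: "g \<in> borel_measurable borel" unfolding gz[abs_def] by measurable
  show "0 \<le> g z" for z unfolding gz by (rule integral_nonneg_AE) (simp add: f0)
  show "g z \<le> K" for z
    using integral_mono[OF int, of "\<lambda>_. K" z] fK \<mu>.prob_space by (simp add: gz)
  have gnn: "(\<integral>\<^sup>+x. ennreal (f (z - x)) \<partial>\<mu>) = ennreal (g z)" for z
    unfolding gz by (rule nn_integral_eq_integral[OF int]) (simp add: f0)
  have dY: "distr \<Omega> borel Y = density lborel (\<lambda>x. ennreal (f x))"
    using distributed_distr_eq_density[OF Y] by (simp cong: distr_cong)
  have "prob_space (distr \<Omega> borel Y)" by (rule prob_space_distr) simp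
  then have finY: "finite_measure (density lborel (\<lambda>x. ennreal (f x)))"
    unfolding dY by (simp add: prob_space.axioms(1) prob_space_def)
  have "distr \<Omega> borel (\<lambda>\<omega>. X \<omega> + Y \<omega>) = density lborel (\<lambda>x. ennreal (g x))"
  proof (rule measure_eqI)
    fix A assume "A \<in> sets (distr \<Omega> borel (\<lambda>\<omega>. X \<omega> + Y \<omega>))"
    then have A[measurable]: "A \<in> sets borel" by simp
    have "emeasure (distr \<Omega> borel (\<lambda>\<omega>. X \<omega> + Y \<omega>)) A = emeasure (convolution \<mu> (density lborel (\<lambda>x. ennreal (f x)))) A"
      unfolding \<mu>_def dY[symmetric] by (subst sum_indep_random_variable[OF ind]) auto
    also have "\<dots> = (\<integral>\<^sup>+x. \<integral>\<^sup>+y. indicator A (x + y) \<partial>density lborel (\<lambda>x. ennreal (f x)) \<partial>\<mu>)"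
      by (rule convolution_emeasure'[OF A _ finY]) (simp_all add: \<mu>.finite_measure_axioms)
    also have "\<dots> = (\<integral>\<^sup>+x. \<integral>\<^sup>+z. ennreal (f (z - x)) * indicator A z \<partial>lborel \<partial>\<mu>)"
    proof (rule nn_integral_cong)
      fix x
      have "(\<integral>\<^sup>+y. indicator A (x + y) \<partial>density lborel (\<lambda>x. ennreal (f x))) = (\<integral>\<^sup>+y. ennreal (f y) * indicator A (x + y) \<partial>lborel)"
        by (subst nn_integral_density) auto
      also have "\<dots> = (\<integral>\<^sup>+z. ennreal (f (z - x)) * indicator A z \<partial>lborel)"
        by (subst nn_integral_real_affine[where c = 1 and t = "- x"]) (auto simp: algebra_simps)
      finally show "(\<integral>\<^sup>+y. indicator A (x + y) \<partial>density lborel (\<lambda>x. ennreal (f x)))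
         = (\<integral>\<^sup>+z. ennreal (f (z - x)) * indicator A z \<partial>lborel)" .
    qed
    also have "\<dots> = (\<integral>\<^sup>+z. \<integral>\<^sup>+x. ennreal (f (z - x)) * indicator A z \<partial>\<mu> \<partial>lborel)"
      by (rule pm.Fubini'[symmetric]) measurable
    also have "\<dots> = (\<integral>\<^sup>+z. ennreal (g z) * indicator A z \<partial>lborel)"
      by (intro nn_integral_cong) (simp add: nn_integral_multc gnn)
    also have "\<dots> = emeasure (density lborel (\<lambda>x. ennreal (g x))) A"
      using gm by (subst emeasure_density) auto
    finally show "emeasure (distr \<Omega> borel (\<lambda>\<omega>. X \<omega> + Y \<omega>)) A = emeasure (density lborel (\<lambda>x. ennreal (g x))) A" .
  qed simp
  then show "distributed \<Omega> lborel (\<lambda>\<omega>. X \<omega> + Y \<omega>) (\<lambda>x. ennreal (g x))"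
    unfolding distributed_def using gm by (auto cong: distr_cong)
qed

lemma (in prob_space) variance_sum_indep:
  fixes X Y :: "'a \<Rightarrow> real"
  assumes ind: "indep_var borel X borel Y"
    and X2: "integrable M (\<lambda>\<omega>. (X \<omega>)\<^sup>2)" and Y2: "integrable M (\<lambda>\<omega>. (Y \<omega>)\<^sup>2)"
  shows "integrable M (\<lambda>\<omega>. (X \<omega> + Y \<omega>)\<^sup>2)"
    "variance (\<lambda>\<omega>. X \<omega> + Y \<omega>) = variance X + variance Y"
    "expectation (\<lambda>\<omega>. X \<omega> + Y \<omega>) = expectation X + expectation Y"
proof -
  have rv[measurable]: "X \<in> borel_measurable M" "Y \<in> borel_measurable M"
    using ind by (auto dest: indep_var_rv1 indep_var_rv2)
  have X1: "integrable M X" and Y1: "integrable M Y"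
    using square_integrable_imp_integrable[OF rv(1) X2] square_integrable_imp_integrable[OF rv(2) Y2] by auto
  have XY: "integrable M (\<lambda>\<omega>. X \<omega> * Y \<omega>)" by (rule indep_var_integrable[OF ind X1 Y1])
  have eXY: "expectation (\<lambda>\<omega>. X \<omega> * Y \<omega>) = expectation X * expectation Y"
    by (rule indep_var_lebesgue_integral[OF ind X1 Y1])
  have eq: "(\<lambda>\<omega>. (X \<omega> + Y \<omega>)\<^sup>2) = (\<lambda>\<omega>. (X \<omega>)\<^sup>2 + 2 * (X \<omega> * Y \<omega>) + (Y \<omega>)\<^sup>2)"
    by (simp add: power2_eq_square algebra_simps)
  show S2: "integrable M (\<lambda>\<omega>. (X \<omega> + Y \<omega>)\<^sup>2)" unfolding eq using X2 Y2 XY by auto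
  show e: "expectation (\<lambda>\<omega>. X \<omega> + Y \<omega>) = expectation X + expectation Y" using X1 Y1 by simp
  have "expectation (\<lambda>\<omega>. (X \<omega> + Y \<omega>)\<^sup>2) =
     expectation (\<lambda>\<omega>. (X \<omega>)\<^sup>2) + 2 * (expectation X * expectation Y) + expectation (\<lambda>\<omega>. (Y \<omega>)\<^sup>2)"
    unfolding eq using X2 Y2 XY by (simp add: eXY)
  moreover have "integrable M (\<lambda>\<omega>. X \<omega> + Y \<omega>)" using X1 Y1 by simp
  note variance_eq[OF this S2, unfolded e] variance_eq[OF X1 X2] variance_eq[OF Y1 Y2]
  ultimately show "variance (\<lambda>\<omega>. X \<omega> + Y \<omega>) = variance X + variance Y"
    unfolding e by (simp add: power2_eq_square algebra_simps)
qed

lemma regular_density_sum: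
  fixes \<Omega> :: "'c measure" and X Y :: "'c \<Rightarrow> real" and f :: "real \<Rightarrow> real"
  assumes \<Omega>: "prob_space \<Omega>" and ind: "prob_space.indep_var \<Omega> borel X borel Y"
    and Y: "distributed \<Omega> lborel Y (\<lambda>x. ennreal (f x))" and f: "regular_density f"
    and X2: "integrable \<Omega> (\<lambda>\<omega>. (X \<omega>)\<^sup>2)"
    and g: "\<And>z. g z = (\<integral>x. f (z - x) \<partial>distr \<Omega> borel X)"
  shows "distributed \<Omega> lborel (\<lambda>\<omega>. X \<omega> + Y \<omega>) (\<lambda>x. ennreal (g x))" "regular_density g"
    "(\<integral>x. g x * (x - prob_space.expectation \<Omega> X - prob_space.expectation \<Omega> Y)\<^sup>2 \<partial>lborel)
       = prob_space.variance \<Omega> X + prob_space.variance \<Omega> Y"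
proof -
  interpret prob_space \<Omega> by fact
  note D = regular_densityD[OF f]
  note [measurable] = D(1)
  obtain K where K: "\<And>x. f x \<le> K" using f by (auto simp: regular_density_def)
  note S = sum_density[OF \<Omega> ind Y D(1,2) K g]
  show dist: "distributed \<Omega> lborel (\<lambda>\<omega>. X \<omega> + Y \<omega>) (\<lambda>x. ennreal (g x))" by (rule S(1))
  have rv[measurable]: "X \<in> borel_measurable \<Omega>" "Y \<in> borel_measurable \<Omega>"
    using ind by (auto dest: indep_var_rv1 indep_var_rv2)
  have Y2: "integrable \<Omega> (\<lambda>\<omega>. (Y \<omega>)\<^sup>2)"
    using distributed_integrable[OF Y, of "\<lambda>x. x\<^sup>2"] D by (simp add: mult.commute)
  note V = variance_sum_indep[OF ind X2 Y2]
  have "integrable lborel (\<lambda>x. x\<^sup>2 * g x)"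
    using distributed_integrable[OF dist, of "\<lambda>x. x\<^sup>2"] V(1) S(3) by (simp add: mult.commute)
  moreover have "integrable lborel g"
    using distributed_integrable[OF dist, of "\<lambda>x. 1"] S(3) by simp
  moreover have "(\<integral>x. g x \<partial>lborel) = 1"
    using distributed_integral[OF dist, of "\<lambda>x. 1"] S(3) prob_space by simp
  ultimately show "regular_density g" using S(2-4) by (auto simp: regular_density_def)
  have "(\<integral>x. g x * (x - expectation X - expectation Y)\<^sup>2 \<partial>lborel) = variance (\<lambda>\<omega>. X \<omega> + Y \<omega>)"
    by (subst distributed_integral[OF dist]) (simp_all add: S(3) V(3) diff_diff_eq)
  then show "(\<integral>x. g x * (x - expectation X - expectation Y)\<^sup>2 \<partial>lborel) = variance X + variance Y"
    by (simp add: V(2))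
qed

lemma same_law:
  fixes N' :: "'c \<Rightarrow> real"
  assumes N: "distributed M lborel N (\<lambda>x. ennreal (f x))" and N'[measurable]: "N' \<in> borel_measurable \<Omega>"
    and eq: "distr \<Omega> borel N' = distr M borel N" and f: "f \<in> borel_measurable borel" "\<And>x. 0 \<le> f x"
  shows "distributed \<Omega> lborel N' (\<lambda>x. ennreal (f x))"
    "prob_space.expectation \<Omega> N' = prob_space.expectation M N"
    "prob_space.variance \<Omega> N' = prob_space.variance M N"
proof -
  have "distr \<Omega> lborel N' = distr \<Omega> borel N'" by (rule distr_cong) auto
  also have "\<dots> = distr M lborel N" unfolding eq by (rule distr_cong) auto
  also have "\<dots> = density lborel (\<lambda>x. ennreal (f x))" using N by (simp add: distributed_def)
  finally show d: "distributed \<Omega> lborel N' (\<lambda>x. ennreal (f x))"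
    using f by (auto simp: distributed_def)
  have E: "(\<integral>\<omega>. h (N' \<omega>) \<partial>\<Omega>) = (\<integral>\<omega>. h (N \<omega>) \<partial>M)" if [measurable]: "h \<in> borel_measurable borel" for h :: "real \<Rightarrow> real"
    using distributed_integral[OF d, of h] distributed_integral[OF N, of h] f by simp
  show e: "prob_space.expectation \<Omega> N' = prob_space.expectation M N" using E[of "\<lambda>x. x"] by simp
  show "prob_space.variance \<Omega> N' = prob_space.variance M N"
    unfolding e using E[of "\<lambda>x. (x - prob_space.expectation M N)\<^sup>2"] by simp
qed

section \<open>Upper bound on the capacity\<close>

lemma ln_two_pi_exp_one:
  fixes u :: real
  assumes "0 < u"
  shows "ln (2 * pi * exp 1 * u) = ln (2 * pi * u) + 1"
  using assms by (simp add: ln_mult)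

lemma channel_capacity_le:
  fixes N :: "'a \<Rightarrow> real" and f :: "real \<Rightarrow> real"
  assumes P: "0 < P" and M: "prob_space M" and N: "distributed M lborel N (\<lambda>x. ennreal (f x))"
    and f: "regular_density f" and \<sigma>: "0 < \<sigma>" and var: "prob_space.variance M N = \<sigma>\<^sup>2"
  shows "channel_capacity P M N \<le> ereal (1 / 2 * ln (2 * pi * exp 1 * (P + \<sigma>\<^sup>2)) - density_entropy f)"
  unfolding channel_capacity_def
proof (rule Sup_least, clarify)
  fix \<Omega> :: "(real \<times> real) measure" and X N'
  assume \<Omega>: "prob_space \<Omega>" and ind: "prob_space.indep_var \<Omega> borel X borel N'"
    and law: "distr \<Omega> borel N' = distr M borel N" and X2: "integrable \<Omega> (\<lambda>\<omega>. (X \<omega>)\<^sup>2)"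
    and varX: "prob_space.variance \<Omega> X \<le> P"
  interpret prob_space \<Omega> by fact
  note D = regular_densityD[OF f]
  have [measurable]: "N' \<in> borel_measurable \<Omega>" using ind by (auto dest: indep_var_rv2)
  note N' = same_law[OF N this law D(1,2)]
  define g where "g z = (\<integral>x. f (z - x) \<partial>distr \<Omega> borel X)" for z
  note G = regular_density_sum[OF \<Omega> ind N'(1) f X2 g_def]
  define \<tau> where "\<tau> = sqrt (P + \<sigma>\<^sup>2)"
  have \<tau>2: "\<tau>\<^sup>2 = P + \<sigma>\<^sup>2" using P by (simp add: \<tau>_def)
  have pos: "0 < P + \<sigma>\<^sup>2" using P by (simp add: add_pos_nonneg)
  have \<tau>: "0 < \<tau>" using pos by (simp add: \<tau>_def)
  define m where "m = expectation X + expectation N'"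
  have "density_entropy g \<le> 1 / 2 * ln (2 * pi * \<tau>\<^sup>2) + (\<integral>x. g x * (x - m)\<^sup>2 \<partial>lborel) / (2 * \<tau>\<^sup>2)"
    by (rule density_entropy_le_gaussian[OF G(2) \<tau>])
  also have "(\<integral>x. g x * (x - m)\<^sup>2 \<partial>lborel) = variance X + \<sigma>\<^sup>2"
    using G(3) by (simp add: m_def diff_diff_eq N'(3) var)
  also have "1 / 2 * ln (2 * pi * \<tau>\<^sup>2) + (variance X + \<sigma>\<^sup>2) / (2 * \<tau>\<^sup>2)
     \<le> 1 / 2 * ln (2 * pi * \<tau>\<^sup>2) + \<tau>\<^sup>2 / (2 * \<tau>\<^sup>2)"
    using varX pos unfolding \<tau>2 by (intro add_left_mono divide_right_mono) auto
  also have "\<tau>\<^sup>2 / (2 * \<tau>\<^sup>2) = 1 / 2" using \<tau> by simp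
  also have "1 / 2 * ln (2 * pi * \<tau>\<^sup>2) + 1 / 2 = 1 / 2 * ln (2 * pi * exp 1 * (P + \<sigma>\<^sup>2))"
    unfolding \<tau>2 ln_two_pi_exp_one[OF pos] by simp
  finally have "density_entropy g \<le> 1 / 2 * ln (2 * pi * exp 1 * (P + \<sigma>\<^sup>2))" .
  moreover have "differential_entropy \<Omega> (\<lambda>\<omega>. X \<omega> + N' \<omega>) = density_entropy g"
    by (rule differential_entropy_eq[OF \<Omega> G(1)]) (rule regular_densityD(2)[OF G(2)])
  moreover have "differential_entropy \<Omega> N' = density_entropy f"
    by (rule differential_entropy_eq[OF \<Omega> N'(1) D(2)])
  ultimately show "ereal (differential_entropy \<Omega> (\<lambda>\<omega>. X \<omega> + N' \<omega>) - differential_entropy \<Omega> N')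
     \<le> ereal (1 / 2 * ln (2 * pi * exp 1 * (P + \<sigma>\<^sup>2)) - density_entropy f)" by simp
qed

section \<open>Gaussian noise is the worst\<close>

lemma normal_density_convolution:
  assumes "0 < \<sigma>" "0 < \<rho>"
  shows "integrable lborel (\<lambda>x. normal_density 0 \<rho> x * normal_density m \<sigma> (z - x))"
    "(\<integral>x. normal_density 0 \<rho> x * normal_density m \<sigma> (z - x) \<partial>lborel) = normal_density m (sqrt (\<rho>\<^sup>2 + \<sigma>\<^sup>2)) z"
proof -
  have shift: "normal_density m s y = normal_density 0 s (y - m)" for s y :: real
    by (simp add: normal_density_def)
  have "(\<integral>\<^sup>+x. ennreal (normal_density 0 \<sigma> (z - m - x) * normal_density 0 \<rho> x) \<partial>lborel)
     = ennreal (normal_density 0 (sqrt (\<sigma>\<^sup>2 + \<rho>\<^sup>2)) (z - m))"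
    using fun_cong[OF conv_normal_density_zero_mean[OF assms], of "z - m"] .
  then have nn: "(\<integral>\<^sup>+x. ennreal (normal_density 0 \<rho> x * normal_density m \<sigma> (z - x)) \<partial>lborel)
     = ennreal (normal_density m (sqrt (\<rho>\<^sup>2 + \<sigma>\<^sup>2)) z)"
    unfolding shift[of \<sigma>] shift[of "sqrt (\<rho>\<^sup>2 + \<sigma>\<^sup>2)"] by (simp add: algebra_simps)
  show "integrable lborel (\<lambda>x. normal_density 0 \<rho> x * normal_density m \<sigma> (z - x))"
    by (rule integrableI_nn_integral_finite[OF _ _ nn]) auto
  show "(\<integral>x. normal_density 0 \<rho> x * normal_density m \<sigma> (z - x) \<partial>lborel) = normal_density m (sqrt (\<rho>\<^sup>2 + \<sigma>\<^sup>2)) z"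
    by (rule integral_eq_nn_integral[THEN trans]) (auto simp: nn)
qed

text \<open>
  Data processing for relative entropy: adding an independent Gaussian to variables with densities \<open>f\<close> and
  \<open>normal_density m \<sigma>\<close> brings them closer. At a fixed \<open>z\<close>, with \<open>c\<close> the ratio of the two convolved densities there, apply
  \<open>f ln f \<ge> f ln (c \<gamma>) + f - c \<gamma>\<close> with \<open>\<gamma>\<close> the Gaussian density and average over the added variable: the last two
  terms cancel by the choice of \<open>c\<close>. Then integrate over \<open>z\<close>.
\<close>
lemma relative_entropy_convolution:
  fixes f g :: "real \<Rightarrow> real"
  assumes f: "regular_density f" and g: "regular_density g" and \<sigma>: "0 < \<sigma>" and \<rho>: "0 < \<rho>"
    and gf: "\<And>z. g z = (\<integral>x. normal_density 0 \<rho> x * f (z - x) \<partial>lborel)"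
  defines "\<tau> \<equiv> sqrt (\<rho>\<^sup>2 + \<sigma>\<^sup>2)"
  shows "(\<integral>z. g z * ln (g z) - g z * ln (normal_density m \<tau> z) \<partial>lborel)
     \<le> (\<integral>y. f y * ln (f y) - f y * ln (normal_density m \<sigma> y) \<partial>lborel)"
proof -
  note D = regular_densityD[OF f]
  note [measurable] = D(1)
  define F where "F y = f y * ln (f y) - f y * ln (normal_density m \<sigma> y)" for y
  define \<phi> where "\<phi> = normal_density 0 \<rho>"
  have \<phi>0: "0 < \<phi> x" for x using \<rho> by (simp add: \<phi>_def normal_density_pos)
  have [measurable]: "\<phi> \<in> borel_measurable borel" by (simp add: \<phi>_def)
  have \<tau>: "0 < \<tau>" using \<sigma> \<rho> by (simp add: \<tau>_def add_pos_pos)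
  have F: "integrable lborel F"
    unfolding F_def using regular_density_entropy_integrable[OF f] integral_ln_normal_density(1)[OF f \<sigma>] by auto
  note [measurable] = borel_measurable_integrable[OF F, simplified]
  have \<phi>1: "integrable lborel \<phi>" "(\<integral>x. \<phi> x \<partial>lborel) = 1" using \<rho> by (auto simp: \<phi>_def)
  have shift: "integrable lborel (\<lambda>z. h (z - x))" "(\<integral>z. h (z - x) \<partial>lborel) = (\<integral>z. h z \<partial>lborel)"
    if "integrable lborel h" for h :: "real \<Rightarrow> real" and x
    using lborel_integrable_real_affine[OF that, of 1 "- x"] lborel_integral_real_affine[of 1 h "- x"]
    by simp_all
  have refl: "integrable lborel (\<lambda>x. h (z - x))" "(\<integral>x. h (z - x) \<partial>lborel) = (\<integral>x. h x \<partial>lborel)"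
    if "integrable lborel h" for h :: "real \<Rightarrow> real" and z
    using lborel_integrable_real_affine[OF that, of "- 1" z] lborel_integral_real_affine[of "- 1" h z]
    by simp_all
  have pair: "integrable (lborel \<Otimes>\<^sub>M lborel) (\<lambda>(x, z). \<phi> x * F (z - x))"
  proof (rule lborel_pair.Fubini_integrable)
    show "(\<lambda>(x, z). \<phi> x * F (z - x)) \<in> borel_measurable (lborel \<Otimes>\<^sub>M lborel)" by measurable
    have "(\<integral>z. norm (\<phi> x * F (z - x)) \<partial>lborel) = \<phi> x * (\<integral>z. \<bar>F z\<bar> \<partial>lborel)" for x
      using shift(2)[OF integrable_abs[OF F], of x] \<phi>0[of x] by (simp add: abs_mult)
    then show "integrable lborel (\<lambda>x. \<integral>z. norm (case (x, z) of (x, z) \<Rightarrow> \<phi> x * F (z - x)) \<partial>lborel)"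
      using \<phi>1 by simp
    show "AE x in lborel. integrable lborel (\<lambda>z. case (x, z) of (x, z) \<Rightarrow> \<phi> x * F (z - x))"
      using shift(1)[OF F] by simp
  qed
  have Ffub: "(\<integral>z. \<integral>x. \<phi> x * F (z - x) \<partial>lborel \<partial>lborel) = (\<integral>y. F y \<partial>lborel)"
    using lborel_pair.Fubini_integral[OF pair] shift(2)[OF F] \<phi>1 by simp
  have Fint: "integrable lborel (\<lambda>z. \<integral>x. \<phi> x * F (z - x) \<partial>lborel)"
    using lborel_pair.integrable_snd[OF pair] by simp
  have AEint: "AE z in lborel. integrable lborel (\<lambda>x. \<phi> x * F (z - x))"
    using lborel_pair.AE_integrable_snd[OF pair] by simp
  obtain K where K: "\<And>x. f x \<le> K" using f by (auto simp: regular_density_def)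
  have \<phi>f: "integrable lborel (\<lambda>x. \<phi> x * f (z - x))" for z
  proof (rule Bochner_Integration.integrable_bound)
    show "integrable lborel (\<lambda>x. K * \<phi> x)" using \<phi>1 by simp
    have "0 \<le> K" using K[of 0] D(2)[of 0] by linarith
    then have "norm (\<phi> x * f (z - x)) \<le> norm (K * \<phi> x)" for x
      using mult_left_mono[OF K[of "z - x"] less_imp_le[OF \<phi>0[of x]]] D(2)[of "z - x"] \<phi>0[of x]
      by (simp add: abs_mult mult.commute[of K])
    then show "AE x in lborel. norm (\<phi> x * f (z - x)) \<le> norm (K * \<phi> x)" by simp
  qed measurable
  have gpos: "0 < g z" for z
  proof (rule ccontr)
    assume "\<not> 0 < g z"
    then have "(\<integral>x. \<phi> x * f (z - x) \<partial>lborel) = 0"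
      using regular_densityD(2)[OF g, of z] gf[of z] by (simp add: \<phi>_def)
    then have "AE x in lborel. \<phi> x * f (z - x) = 0"
      by (subst (asm) integral_nonneg_eq_0_iff_AE[OF \<phi>f]) (auto simp: D(2) less_imp_le[OF \<phi>0])
    then have "AE x in lborel. f (z - x) = 0"
      by eventually_elim (use \<phi>0 in \<open>simp add: less_imp_neq[symmetric]\<close>)
    then have "(\<integral>x. f (z - x) \<partial>lborel) = 0" by (rule integral_eq_zero_AE)
    then show False using refl(2)[OF D(3), of z] D(4) by simp
  qed
  have main: "AE z in lborel. g z * ln (g z) - g z * ln (normal_density m \<tau> z) \<le> (\<integral>x. \<phi> x * F (z - x) \<partial>lborel)"
    using AEint
  proof eventually_elim
    case (elim z)
    define c where "c = g z / normal_density m \<tau> z"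
    have c: "0 < c" using gpos \<tau> by (simp add: c_def normal_density_pos)
    note conv = normal_density_convolution[OF \<sigma> \<rho>, of m z, folded \<phi>_def \<tau>_def]
    have i: "integrable lborel (\<lambda>x. (ln c + 1) * (\<phi> x * f (z - x)) - c * (\<phi> x * normal_density m \<sigma> (z - x)))"
      using \<phi>f conv(1) by auto
    have "(\<integral>x. (ln c + 1) * (\<phi> x * f (z - x)) - c * (\<phi> x * normal_density m \<sigma> (z - x)) \<partial>lborel)
      \<le> (\<integral>x. \<phi> x * F (z - x) \<partial>lborel)"
    proof (rule integral_mono[OF i elim])
      fix x
      let ?\<gamma> = "normal_density m \<sigma> (z - x)"
      have \<gamma>: "0 < ?\<gamma>" using \<sigma> by (simp add: normal_density_pos)
      have "f (z - x) * ln (c * ?\<gamma>) + f (z - x) - c * ?\<gamma> \<le> f (z - x) * ln (f (z - x))"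
        using c \<gamma> D(2) by (intro mult_ln_ge) auto
      then have "(ln c + 1) * f (z - x) - c * ?\<gamma> \<le> F (z - x)"
        using c \<gamma> by (simp add: F_def ln_mult algebra_simps)
      then have "\<phi> x * ((ln c + 1) * f (z - x) - c * ?\<gamma>) \<le> \<phi> x * F (z - x)"
        using \<phi>0[of x] by (intro mult_left_mono) auto
      then show "(ln c + 1) * (\<phi> x * f (z - x)) - c * (\<phi> x * ?\<gamma>) \<le> \<phi> x * F (z - x)"
        by (simp add: algebra_simps)
    qed
    also have "(\<integral>x. (ln c + 1) * (\<phi> x * f (z - x)) - c * (\<phi> x * normal_density m \<sigma> (z - x)) \<partial>lborel)
      = (ln c + 1) * g z - c * normal_density m \<tau> z"
      using \<phi>f conv by (subst Bochner_Integration.integral_diff) (auto simp: gf \<phi>_def)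
    also have "\<dots> = g z * ln (g z) - g z * ln (normal_density m \<tau> z)"
      using gpos[of z] normal_density_pos[OF \<tau>, of m z]
      by (simp add: c_def ln_div algebra_simps)
    finally show ?case .
  qed
  have "(\<integral>z. g z * ln (g z) - g z * ln (normal_density m \<tau> z) \<partial>lborel)
    \<le> (\<integral>z. \<integral>x. \<phi> x * F (z - x) \<partial>lborel \<partial>lborel)"
    by (rule integral_mono_AE[OF _ Fint main])
      (use regular_density_entropy_integrable[OF g] integral_ln_normal_density(1)[OF g \<tau>] in auto)
  then show ?thesis unfolding Ffub unfolding F_def .
qed

text \<open>
  The product space is used for the input and the noise in the lower bound on the capacity.
\<close>
lemma product_realisation:
  fixes A B :: "real measure"
  assumes A: "prob_space A" "sets A = sets borel" and B: "prob_space B" "sets B = sets borel"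
  shows "prob_space (A \<Otimes>\<^sub>M B)" "distr (A \<Otimes>\<^sub>M B) borel fst = A" "distr (A \<Otimes>\<^sub>M B) borel snd = B"
    "prob_space.indep_var (A \<Otimes>\<^sub>M B) borel fst borel snd"
proof -
  interpret A: prob_space A by fact
  interpret B: prob_space B by fact
  interpret pair_prob_space A B ..
  note [measurable_cong] = A(2) B(2)
  have sp: "space A = UNIV" "space B = UNIV"
    using sets_eq_imp_space_eq[OF A(2)] sets_eq_imp_space_eq[OF B(2)] by auto
  show "prob_space (A \<Otimes>\<^sub>M B)" by (rule prob_space_axioms)
  show 1: "distr (A \<Otimes>\<^sub>M B) borel fst = A"
    by (rule measure_eqI)
      (auto simp: A(2) emeasure_distr sp space_pair_measure fst_vimage_eq_Times vimage_fst
        B.emeasure_pair_measure_Times B.emeasure_space_1[unfolded sp])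
  show 2: "distr (A \<Otimes>\<^sub>M B) borel snd = B"
    by (rule measure_eqI)
      (auto simp: B(2) emeasure_distr sp space_pair_measure vimage_snd
        B.emeasure_pair_measure_Times A.emeasure_space_1[unfolded sp])
  have "distr (A \<Otimes>\<^sub>M B) (borel \<Otimes>\<^sub>M borel) (\<lambda>x. (fst x, snd x)) = A \<Otimes>\<^sub>M B"
    by (simp add: distr_id2 sets_pair_measure_cong[OF A(2) B(2)])
  then show "indep_var borel fst borel snd"
    unfolding indep_var_distribution_eq 1 2 by simp
qed

text \<open>
  The input is a centred Gaussian of variance \<open>P\<close>. Noise and output are compared with Gaussians of the same mean and
  variance; the logarithms of these are quadratic, so their integrals depend on mean and variance only, and data processing
  becomes a lower bound for the difference of the entropies.
\<close>
lemma channel_capacity_ge: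
  fixes N :: "'a \<Rightarrow> real" and f :: "real \<Rightarrow> real"
  assumes P: "0 < P" and M: "prob_space M" and N: "distributed M lborel N (\<lambda>x. ennreal (f x))"
    and f: "regular_density f" and \<sigma>: "0 < \<sigma>" and var: "prob_space.variance M N = \<sigma>\<^sup>2"
  shows "ereal (1 / 2 * ln (2 * pi * (P + \<sigma>\<^sup>2)) - 1 / 2 * ln (2 * pi * \<sigma>\<^sup>2)) \<le> channel_capacity P M N"
proof -
  note D = regular_densityD[OF f]
  note [measurable] = D(1)
  define \<rho> where "\<rho> = sqrt P"
  have \<rho>: "0 < \<rho>" "\<rho>\<^sup>2 = P" using P by (auto simp: \<rho>_def)
  define A B where "A = density lborel (\<lambda>x. ennreal (normal_density 0 \<rho> x))"
    and "B = density lborel (\<lambda>x. ennreal (f x))"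
  define \<Omega> where "\<Omega> = A \<Otimes>\<^sub>M B"
  have pA: "prob_space A" unfolding A_def by (rule prob_space_normal_density[OF \<rho>(1)])
  have BN: "B = distr M borel N"
  proof -
    have "distr M borel N = distr M lborel N" by (rule distr_cong) auto
    then show ?thesis using N by (simp add: distributed_def B_def)
  qed
  have rvN: "N \<in> borel_measurable M" using N by (simp add: distributed_def)
  have pB: "prob_space B" unfolding BN by (rule prob_space.prob_space_distr[OF M rvN])
  have sAB: "sets A = sets borel" "sets B = sets borel" by (simp_all add: A_def B_def)
  note R = product_realisation[OF pA sAB(1) pB sAB(2), folded \<Omega>_def]
  interpret prob_space \<Omega> by (rule R(1))
  have rv[measurable]: "fst \<in> borel_measurable \<Omega>" "snd \<in> borel_measurable \<Omega>"
    using R(4) by (auto dest: indep_var_rv1 indep_var_rv2)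
  have law: "distr \<Omega> borel snd = distr M borel N" using R(3) BN by simp
  note N' = same_law[OF N rv(2) law D(1,2)]
  have X: "distributed \<Omega> lborel fst (\<lambda>x. ennreal (normal_density 0 \<rho> x))"
  proof -
    have "distr \<Omega> lborel fst = distr \<Omega> borel fst" by (rule distr_cong) auto
    then show ?thesis using R(2) by (simp add: distributed_def A_def)
  qed
  have X2: "integrable \<Omega> (\<lambda>\<omega>. (fst \<omega>)\<^sup>2)"
    using distributed_integrable[OF X, of "\<lambda>x. x\<^sup>2"] integrable_normal_moment[OF \<rho>(1), of 0 2] by simp
  have varX: "variance fst = P"
    using normal_distributed_variance[OF \<rho>(1) X] \<rho>(2) by simp
  have eX: "expectation fst = 0" by (rule normal_distributed_expectation[OF \<rho>(1) X])
  define g where "g z = (\<integral>x. f (z - x) \<partial>distr \<Omega> borel fst)" for z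
  note G = regular_density_sum[OF R(1) R(4) N'(1) f X2 g_def]
  have gz: "g z = (\<integral>x. normal_density 0 \<rho> x * f (z - x) \<partial>lborel)" for z
    unfolding g_def R(2) A_def by (subst integral_density) auto
  define m where "m = prob_space.expectation M N"
  define \<tau> where "\<tau> = sqrt (\<rho>\<^sup>2 + \<sigma>\<^sup>2)"
  have \<tau>: "0 < \<tau>" "\<tau>\<^sup>2 = P + \<sigma>\<^sup>2"
    using \<rho> \<sigma> by (auto simp: \<tau>_def add_pos_pos)
  have nz: "2 * P + 2 * \<sigma>\<^sup>2 \<noteq> 0" using P zero_le_power2[of \<sigma>] by linarith
  have vg: "(\<integral>x. g x * (x - m)\<^sup>2 \<partial>lborel) = \<tau>\<^sup>2"
    using G(3) unfolding varX N'(3) var unfolding eX N'(2) by (simp add: m_def \<tau>(2))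
  have vf: "(\<integral>x. f x * (x - m)\<^sup>2 \<partial>lborel) = \<sigma>\<^sup>2"
    using distributed_integral[OF N, of "\<lambda>x. (x - m)\<^sup>2"] D(2) var by (simp add: m_def)
  have "(\<integral>z. g z * ln (g z) - g z * ln (normal_density m \<tau> z) \<partial>lborel)
     \<le> (\<integral>y. f y * ln (f y) - f y * ln (normal_density m \<sigma> y) \<partial>lborel)"
    unfolding \<tau>_def by (rule relative_entropy_convolution[OF f G(2) \<sigma> \<rho>(1) gz])
  also have "(\<integral>z. g z * ln (g z) - g z * ln (normal_density m \<tau> z) \<partial>lborel)
     = - density_entropy g + (1 / 2 * ln (2 * pi * (P + \<sigma>\<^sup>2)) + 1 / 2)"
    using regular_density_entropy_integrable[OF G(2)] integral_ln_normal_density[OF G(2) \<tau>(1), of m] vg \<tau> nz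
    by (simp add: density_entropy_def)
  also have "(\<integral>y. f y * ln (f y) - f y * ln (normal_density m \<sigma> y) \<partial>lborel)
     = - density_entropy f + (1 / 2 * ln (2 * pi * \<sigma>\<^sup>2) + 1 / 2)"
    using regular_density_entropy_integrable[OF f] integral_ln_normal_density[OF f \<sigma>, of m] vf \<sigma>
    by (simp add: density_entropy_def)
  finally have le: "1 / 2 * ln (2 * pi * (P + \<sigma>\<^sup>2)) - 1 / 2 * ln (2 * pi * \<sigma>\<^sup>2) \<le> density_entropy g - density_entropy f"
    by linarith
  have "differential_entropy \<Omega> (\<lambda>\<omega>. fst \<omega> + snd \<omega>) = density_entropy g"
    by (rule differential_entropy_eq[OF R(1) G(1)]) (rule regular_densityD(2)[OF G(2)])
  moreover have "differential_entropy \<Omega> snd = density_entropy f"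
    by (rule differential_entropy_eq[OF R(1) N'(1) D(2)])
  ultimately have "ereal (density_entropy g - density_entropy f) \<le> channel_capacity P M N"
    unfolding channel_capacity_def using R(1,4) law X2 varX
    by (intro Sup_upper CollectI exI[of _ \<Omega>] exI[of _ fst] exI[of _ snd]) auto
  then show ?thesis using le by (auto intro: order_trans[rotated])
qed

section \<open>Log-concave noise against Gaussian noise\<close>

lemma regular_normal_density:
  assumes "0 < \<sigma>"
  shows "regular_density (normal_density \<mu> \<sigma>)"
  unfolding regular_density_def
proof (intro conjI allI exI)
  show "normal_density \<mu> \<sigma> x \<le> 1 / sqrt (2 * pi * \<sigma>\<^sup>2)" for x
    using assms by (auto simp: normal_density_def intro!: divide_right_mono)
  have "integrable lborel (\<lambda>x. normal_density \<mu> \<sigma> x * (x - \<mu>)\<^sup>2 + 2 * \<mu> * (normal_density \<mu> \<sigma> x * x) - \<mu>\<^sup>2 * normal_density \<mu> \<sigma> x)"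
    using assms integrable_normal_moment[OF assms, of \<mu> 2] integrable_normal_moment_nz_1[OF assms, of \<mu>] by auto
  then show "integrable lborel (\<lambda>x. x\<^sup>2 * normal_density \<mu> \<sigma> x)"
    by (simp add: power2_eq_square algebra_simps)
qed (use assms in auto)

lemma regular_log_concave_density:
  fixes N :: "'a \<Rightarrow> real"
  assumes M: "prob_space M" and W: "ereal_convex W"
    and N: "distributed M lborel N (\<lambda>x. ennreal (exp_minus (W x)))"
    and N2: "integrable M (\<lambda>\<omega>. (N \<omega>)\<^sup>2)"
  shows "regular_density (\<lambda>x. exp_minus (W x))"
proof -
  interpret prob_space M by fact
  have "(\<lambda>x. enn2real (ennreal (exp_minus (W x)))) \<in> borel_measurable lborel"
    using distributed_borel_measurable[OF N] by measurable
  then have [measurable]: "(\<lambda>x. exp_minus (W x)) \<in> borel_measurable borel" by simp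
  have i: "integrable lborel (\<lambda>x. exp_minus (W x))"
    using distributed_integrable[OF N, of "\<lambda>x. 1"] by simp
  have one: "(\<integral>x. exp_minus (W x) \<partial>lborel) = 1"
    using distributed_integral[OF N, of "\<lambda>x. 1"] prob_space by simp
  obtain K where "\<And>x. exp_minus (W x) \<le> K" using log_concave_density_bounded[OF W i one] by blast
  moreover have "integrable lborel (\<lambda>x. x\<^sup>2 * exp_minus (W x))"
    using distributed_integrable[OF N, of "\<lambda>x. x\<^sup>2"] N2 by (simp add: mult.commute)
  ultimately show ?thesis using i one by (auto simp: regular_density_def)
qed

lemma log_concave_entropy_ge:
  fixes N :: "'a \<Rightarrow> real"
  assumes M: "prob_space M" and W: "ereal_convex W"
    and N: "distributed M lborel N (\<lambda>x. ennreal (exp_minus (W x)))"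
    and N2: "integrable M (\<lambda>\<omega>. (N \<omega>)\<^sup>2)"
    and \<sigma>: "0 < \<sigma>" and var: "prob_space.variance M N = \<sigma>\<^sup>2"
  shows "1 + ln \<sigma> \<le> density_entropy (\<lambda>x. exp_minus (W x))"
proof -
  interpret prob_space M by fact
  let ?f = "\<lambda>x. exp_minus (W x)"
  have f: "regular_density ?f" by (rule regular_log_concave_density[OF M W N N2])
  note D = regular_densityD[OF f]
  have [measurable]: "N \<in> borel_measurable M" using N by (simp add: distributed_def)
  have N1: "integrable M N" by (rule square_integrable_imp_integrable[OF _ N2]) measurable
  have "\<sigma>\<^sup>2 = expectation (\<lambda>\<omega>. (N \<omega>)\<^sup>2) - (expectation N)\<^sup>2"
    using variance_eq[OF N1 N2] var by simp
  also have "\<dots> = (\<integral>x. x\<^sup>2 * ?f x \<partial>lborel) - (\<integral>x. x * ?f x \<partial>lborel)\<^sup>2"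
    using distributed_integral[OF N, of "\<lambda>x. x\<^sup>2"] distributed_integral[OF N, of "\<lambda>x. x"]
    by (simp add: mult.commute)
  also have "\<dots> \<le> exp (2 * density_entropy ?f - 2)"
    using log_concave_variance_le_entropy[OF W D(3,4,5) regular_density_first_moment[OF f]
      regular_density_entropy_integrable[OF f]] by (simp add: density_entropy_def)
  finally have "ln (\<sigma>\<^sup>2) \<le> ln (exp (2 * density_entropy ?f - 2))"
    using \<sigma> by (subst ln_le_cancel_iff) auto
  then show ?thesis using \<sigma> by (simp add: ln_realpow)
qed

lemma density_entropy_normal:
  assumes "0 < \<sigma>"
  shows "density_entropy (normal_density \<mu> \<sigma>) = 1 / 2 * ln (2 * pi * \<sigma>\<^sup>2) + 1 / 2"
  using integral_ln_normal_density(2)[OF regular_normal_density[OF assms, of \<mu>] assms, of \<mu>]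
    integral_normal_moment_even[OF assms, of \<mu> 1] assms
  by (simp add: density_entropy_def)

theorem corollary2p2:
  fixes M :: "'a measure" and N :: "'a \<Rightarrow> real"
    and M' :: "'b measure" and Z :: "'b \<Rightarrow> real"
    and P \<sigma> :: real
  assumes "P > 0"
    and "prob_space M" and "log_concave_rv M N"
    and "prob_space M'"
    and "\<sigma> > 0" and "distributed M' lborel Z (\<lambda>x. ennreal (normal_density 0 \<sigma> x))"
    and "prob_space.variance M' Z = prob_space.variance M N"
  shows "channel_capacity P M' Z \<le> channel_capacity P M N \<and>
         channel_capacity P M N \<le> channel_capacity P M' Z + ereal (1 / 2 * ln (2 * pi / exp 1))"
proof -
  note P = assms(1) and M = assms(2) and M' = assms(4) and \<sigma> = assms(5) and Z = assms(6)
  obtain W where W: "ereal_convex W" and N: "distributed M lborel N (\<lambda>x. ennreal (exp_minus (W x)))"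
    using assms(3) by (auto simp: log_concave_rv_def)
  interpret M: prob_space M by (rule M)
  interpret M': prob_space M' by (rule M')
  have varZ: "M'.variance Z = \<sigma>\<^sup>2" by (rule M'.normal_distributed_variance[OF \<sigma> Z])
  then have varN: "M.variance N = \<sigma>\<^sup>2" using assms(7) by simp
  have [measurable]: "N \<in> borel_measurable M" using N by (simp add: distributed_def)
  define c where "c = M.expectation N"
  \<comment> \<open>The integral of a non-integrable function is 0, so a positive variance implies a finite second moment.\<close>
  have "integrable M (\<lambda>\<omega>. (N \<omega> - c)\<^sup>2)"
    using varN \<sigma> not_integrable_integral_eq[of M "\<lambda>\<omega>. (N \<omega> - c)\<^sup>2"] by (auto simp: c_def)
  then have "integrable M (\<lambda>\<omega>. (N \<omega> - c)\<^sup>2)" "integrable M (\<lambda>\<omega>. N \<omega> - c)"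
    by (auto intro: M.square_integrable_imp_integrable)
  then have "integrable M (\<lambda>\<omega>. (N \<omega> - c)\<^sup>2 + 2 * c * (N \<omega> - c) + c\<^sup>2)" by auto
  then have N2: "integrable M (\<lambda>\<omega>. (N \<omega>)\<^sup>2)" by (simp add: power2_eq_square algebra_simps)
  have f: "regular_density (\<lambda>x. exp_minus (W x))" by (rule regular_log_concave_density[OF M W N N2])
  have \<gamma>: "regular_density (normal_density 0 \<sigma>)" by (rule regular_normal_density[OF \<sigma>])
  define C where "C = 1 / 2 * ln (2 * pi * (P + \<sigma>\<^sup>2)) - 1 / 2 * ln (2 * pi * \<sigma>\<^sup>2)"
  have pos: "0 < P + \<sigma>\<^sup>2" using P by (simp add: add_pos_nonneg)
  have "channel_capacity P M' Z \<le> ereal (1 / 2 * ln (2 * pi * exp 1 * (P + \<sigma>\<^sup>2)) - (1 / 2 * ln (2 * pi * \<sigma>\<^sup>2) + 1 / 2))"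
    using channel_capacity_le[OF P M' Z \<gamma> \<sigma> varZ] by (simp only: density_entropy_normal[OF \<sigma>])
  also have "1 / 2 * ln (2 * pi * exp 1 * (P + \<sigma>\<^sup>2)) - (1 / 2 * ln (2 * pi * \<sigma>\<^sup>2) + 1 / 2) = C"
    unfolding ln_two_pi_exp_one[OF pos] C_def by (simp add: add_divide_distrib)
  finally have Z_le: "channel_capacity P M' Z \<le> ereal C" .
  have Z_ge: "ereal C \<le> channel_capacity P M' Z"
    unfolding C_def by (rule channel_capacity_ge[OF P M' Z \<gamma> \<sigma> varZ])
  have N_ge: "ereal C \<le> channel_capacity P M N"
    unfolding C_def by (rule channel_capacity_ge[OF P M N f \<sigma> varN])
  have "channel_capacity P M N \<le> ereal (1 / 2 * ln (2 * pi * exp 1 * (P + \<sigma>\<^sup>2)) - density_entropy (\<lambda>x. exp_minus (W x)))"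
    by (rule channel_capacity_le[OF P M N f \<sigma> varN])
  also have "\<dots> \<le> ereal (1 / 2 * ln (2 * pi * exp 1 * (P + \<sigma>\<^sup>2)) - (1 + ln \<sigma>))"
    using log_concave_entropy_ge[OF M W N N2 \<sigma> varN] by simp
  also have "1 / 2 * ln (2 * pi * exp 1 * (P + \<sigma>\<^sup>2)) - (1 + ln \<sigma>) = C + 1 / 2 * ln (2 * pi / exp 1)"
    using \<sigma> unfolding ln_two_pi_exp_one[OF pos] C_def by (simp add: ln_mult ln_div ln_realpow add_divide_distrib diff_divide_distrib)
  finally have "channel_capacity P M N \<le> ereal C + ereal (1 / 2 * ln (2 * pi / exp 1))" by simp
  also have "\<dots> \<le> channel_capacity P M' Z + ereal (1 / 2 * ln (2 * pi / exp 1))"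
    using Z_ge by (rule add_right_mono)
  finally show ?thesis using order_trans[OF Z_le N_ge] by simp
qed

end
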